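(* Let $V:\mathbb{S}^1\to\mathbb{R}$ be a $C^2$ function whose maximum is attained at a unique point. For each $k$ let $\pi_{k,V}$ be the stationary probability on $\Gamma_k\subset\mathbb{S}^1$ of the continuous time Gibbs Markov chain associated to $kV_k$, and let $u,u^*:\mathbb{S}^1\to\mathbb{R}$ be the limits, as $k\to\infty$, of $\frac1k\log z_k^V$ and $\frac1k\log p_{\mu_k}^V$ respectively (defined in the context). Then a large deviation principle holds for the sequence of measures $\{\pi_{k,V}\}_k$, with deviation rate function $I^V(x)=u(x)+u^*(x)$. In other words, given an interval $F=[c,d]$, $$\lim_{k\to\infty}\frac1k\log\pi_{k,V}[F]=-\inf\{I^V(x)\mid x\in F\}.$$
   Context: $\mathbb{S}^1$ is the unit circle identified with $[0,1)$, and $\Gamma_k=\{0,1/k,\dots,(k-1)/k\}$, with indices mod $k$. $L_k$ is the $k\times k$ matrix acting on $f:\Gamma_k\to\mathbb{R}$ by $(L_kf)(\frac jk)=f(\frac{j+1}k)+f(\frac{j-1}k)-2f(\frac jk)$. $V_k$ is the restriction of $V$ to $\Gamma_k$, and $kV_k$ is also viewed as the diagonal matrix with entries $kV_k(j/k)$. By the continuous time Perron theorem there are a real $\lambda_k$, a unique positive function $u_k$ on $\Gamma_k$ and a unique probability vector $\mu_k$ on $\Gamma_k$ such that $\sum_j u_k(j/k)\mu_k(j/k)=1$, $(kL_k+kV_k)u_k=\lambda_ku_k$, and $\lim_{t\to\infty}e^{-t\lambda_k}e^{t(kL_k+kV_k)}v=\big(\sum_jv(j/k)\mu_k(j/k)\big)u_k$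 for every $v:\Gamma_k\to\mathbb{R}$. Normalizing the semigroup $e^{t(kL_k+kV_k)}$ by the eigenvalue and eigenfunction, $f\mapsto\frac1{u_k}e^{t(kL_k+kV_k-\lambda_k)}(u_kf)$, gives the stochastic semigroup of the Gibbs Markov chain associated to $kV_k$; its stationary probability is $\pi_{k,V}(j/k)=u_k(j/k)\mu_k(j/k)$. Continuous extension: given $\varphi_k:\Gamma_k\to\mathbb{R}$, let $g_k:\mathbb{S}^1\to\mathbb{R}$ equal $\varphi_k(j/k)$ on $[j/k,(j+1)/k)$, and let $h_k$ be the continuous function equal to $g_k$ outside the small intervals $[\frac jk-\frac1{k^2},\frac jk]$ and interpolating linearly on each of these. The function $z_k^V$ is the $h_k$ obtained from $\varphi_k=u_k$, and $p_{\mu_k}^V$ is the $h_k$ obtained from $\varphi_k=\mu_k$. The families $\frac1k\log z_k^V$ and $\frac1k\log p_{\mu_k}^V$ are equicontinuous; when $V$ has a unique maximum point, their convergent subsequences have unique limits $u$ and $u^*$, with no ambiguity of an additive constant because of the normalization of $u_k$ and $\mu_k$.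
   Formalization: The rate function is taken as I^V = -(u+u* ), not u+u*: since u+u* ≤ 0 and is not identically 0, the printed sign makes the formula false; intervals F=[c,d] are nondegenerate (c<d), as a single point may miss Γ_k for infinitely many k. *)

theory Defs
  imports "HOL-Analysis.Analysis"
begin

text \<open>
  The circle is \<open>\<real>/\<int>\<close>, with fundamental domain \<open>[0,1)\<close>. A function on the circle is a
  function on the reals of period 1, or a function whose values outside \<open>[0,1)\<close> are never used.
\<close>

definition C2_on_circle :: "(real \<Rightarrow> real) \<Rightarrow> bool" where
  "C2_on_circle V \<longleftrightarrow>
     (\<forall>x. V (x + 1) = V x) \<and>
     (\<exists>V' V''. (\<forall>x. (V has_real_derivative V' x) (at x)) \<and>
               (\<forall>x. (V' has_real_derivative V'' x) (at x)) \<and>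
               continuous_on UNIV V'')"

definition has_unique_max_on_circle :: "(real \<Rightarrow> real) \<Rightarrow> bool" where
  "has_unique_max_on_circle V \<longleftrightarrow> (\<exists>!x. x \<in> {0..<1} \<and> (\<forall>y\<in>{0..<1}. V y \<le> V x))"

text \<open>
  The closed arc traversed from \<open>c\<close> to \<open>d\<close>. It may pass through 0, and it is \<open>{c..d}\<close>
  itself when \<open>0 \<le> c\<close> and \<open>d < 1\<close>.
\<close>

definition arc_set :: "real \<Rightarrow> real \<Rightarrow> real set" where
  "arc_set c d = frac ` {c..d}"

text \<open>
  A function \<open>f\<close> on the \<open>k\<close> points \<open>0, 1/k, \<dots>, (k-1)/k\<close> is given by the values
  \<open>f j\<close> at \<open>j/k\<close> for \<open>j < k\<close>. The values \<open>f j\<close> with \<open>j \<ge> k\<close> are irrelevant.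
\<close>

definition walk_gen :: "nat \<Rightarrow> (nat \<Rightarrow> real) \<Rightarrow> nat \<Rightarrow> real" where
  "walk_gen k f j = f ((j + 1) mod k) + f ((j + k - 1) mod k) - 2 * f j"

definition perturbed_gen :: "(real \<Rightarrow> real) \<Rightarrow> nat \<Rightarrow> (nat \<Rightarrow> real) \<Rightarrow> nat \<Rightarrow> real" where
  "perturbed_gen V k f j = real k * walk_gen k f j + real k * V (real j / real k) * f j"

text \<open>The exponential \<open>e\<^sup>t\<^sup>A v\<close> of a linear operator \<open>A\<close>, evaluated at \<open>j\<close>.\<close>

definition op_exp ::
    "((nat \<Rightarrow> real) \<Rightarrow> nat \<Rightarrow> real) \<Rightarrow> real \<Rightarrow> (nat \<Rightarrow> real) \<Rightarrow> nat \<Rightarrow> real" where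
  "op_exp A t v j = (\<Sum>n. t ^ n / fact n * (A ^^ n) v j)"

definition prob_vector :: "nat \<Rightarrow> (nat \<Rightarrow> real) \<Rightarrow> bool" where
  "prob_vector k p \<longleftrightarrow> (\<forall>j<k. 0 \<le> p j) \<and> (\<Sum>j<k. p j) = 1"

text \<open>
  The eigenvalue, eigenfunction and eigenprobability of the continuous time Perron theorem. They
  are determined by these properties (the two functions on \<open>{..<k}\<close>).
\<close>

definition perron_data ::
    "(real \<Rightarrow> real) \<Rightarrow> nat \<Rightarrow> real \<Rightarrow> (nat \<Rightarrow> real) \<Rightarrow> (nat \<Rightarrow> real) \<Rightarrow> bool" where
  "perron_data V k l u \<mu> \<longleftrightarrow>
     (\<forall>j<k. 0 < u j) \<and>
     prob_vector k \<mu> \<and>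
     (\<Sum>j<k. u j * \<mu> j) = 1 \<and>
     (\<forall>j<k. perturbed_gen V k u j = l * u j) \<and>
     (\<forall>v. \<forall>j<k. ((\<lambda>t. exp (- t * l) * op_exp (perturbed_gen V k) t v j)
                    \<longlongrightarrow> (\<Sum>i<k. v i * \<mu> i) * u j) at_top)"

text \<open>The semigroup of the Gibbs Markov chain, for eigenvalue \<open>l\<close> and eigenfunction \<open>u\<close>.\<close>

definition gibbs_semigroup ::
    "(real \<Rightarrow> real) \<Rightarrow> nat \<Rightarrow> real \<Rightarrow> (nat \<Rightarrow> real) \<Rightarrow> real \<Rightarrow> (nat \<Rightarrow> real) \<Rightarrow> nat \<Rightarrow> real" where
  "gibbs_semigroup V k l u t f j =
     1 / u j * op_exp (\<lambda>g i. perturbed_gen V k g i - l * g i) t (\<lambda>i. u i * f i) j"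

definition stationary_prob ::
    "nat \<Rightarrow> (real \<Rightarrow> (nat \<Rightarrow> real) \<Rightarrow> nat \<Rightarrow> real) \<Rightarrow> (nat \<Rightarrow> real) \<Rightarrow> bool" where
  "stationary_prob k P p \<longleftrightarrow>
     prob_vector k p \<and> (\<forall>t\<ge>0. \<forall>f. (\<Sum>j<k. p j * P t f j) = (\<Sum>j<k. p j * f j))"

definition lattice_measure :: "nat \<Rightarrow> (nat \<Rightarrow> real) \<Rightarrow> real set \<Rightarrow> real" where
  "lattice_measure k p F = (\<Sum>j | j < k \<and> real j / real k \<in> F. p j)"

text \<open>
  Continuous extension to the circle: the value is \<open>\<phi> j\<close> on \<open>[j/k, (j+1)/k - 1/k\<^sup>2]\<close>, followed
  by linear interpolation from \<open>\<phi> j\<close> to the next value on \<open>[(j+1)/k - 1/k\<^sup>2, (j+1)/k]\<close>.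
\<close>

definition cont_ext :: "nat \<Rightarrow> (nat \<Rightarrow> real) \<Rightarrow> real \<Rightarrow> real" where
  "cont_ext k \<phi> x =
     (let j = nat \<lfloor>real k * frac x\<rfloor>;
          a = (real j + 1) / real k - 1 / (real k)\<^sup>2
      in if frac x \<le> a then \<phi> j
         else \<phi> j + (\<phi> ((j + 1) mod k) - \<phi> j) * ((frac x - a) * (real k)\<^sup>2))"

text \<open>
  Sign convention: when \<open>u\<close> and \<open>u'\<close> are the limits of \<open>1/k log z\<^sub>k\<close> and \<open>1/k log p\<^sub>k\<close> for the
  continuous extensions \<open>z\<^sub>k\<close>, \<open>p\<^sub>k\<close> of the eigenfunction and the eigenprobability, \<open>u + u'\<close> is
  the exponential growth rate of point probabilities, so it is \<open>\<le> 0\<close>. The nonnegative rate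
  function in \<open>lim 1/k log \<pi>\<^sub>k(F) = - inf\<^sub>F I\<close> is therefore its negative.
\<close>

definition deviation_rate :: "(real \<Rightarrow> real) \<Rightarrow> (real \<Rightarrow> real) \<Rightarrow> real \<Rightarrow> real" where
  "deviation_rate u u' x = - (u x + u' x)"

end

theory Submission
  imports Defs
begin

text \<open>
  The generator is a symmetric matrix, so the left and the right Perron eigenvectors agree up to a
  factor: \<open>\<mu>\<^sub>k = u\<^sub>k / (\<Sum>u\<^sub>k)\<close> (\<open>perron_left_eq\<close>). Differentiating stationarity at \<open>t = 0\<close> shows
  that \<open>\<pi>\<^sub>k / u\<^sub>k\<close> is also a left eigenvector, hence \<open>\<pi>\<^sub>k = u\<^sub>k \<mu>\<^sub>k\<close> (\<open>stationary_prob_eq\<close>). The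
  normalization confines \<open>max u\<^sub>k\<close> and \<open>\<Sum>u\<^sub>k\<close> to powers of \<open>k\<close> (\<open>perron_normalization\<close>), which are
  invisible at exponential scale. So everything reduces to the exponential profile of one positive
  periodic solution \<open>w\<close> of the difference equation
  \<open>w (i + 1) + w (i - 1) = (2 + r - V (i / k)) * w i\<close>.

  This profile is a WKB asymptotic. Let \<open>m\<close> be the maximum point of \<open>V\<close>. At \<open>r = V m\<close>,
  the limit of the eigenvalues, the local solutions of the equation grow or decay by factors \<open>exp (\<plusminus> G (i / k))\<close> per
  step, where \<open>2 cosh G = 2 + V m - V\<close>, so \<open>w\<close> should decay away from \<open>m\<close> like \<open>exp (- k D)\<close>, with
  \<open>D x\<close> the integral of \<open>G\<close> along the cheaper of the two arcs from \<open>m\<close> to \<open>x\<close>. The proof is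
  elementary. The ratios of neighbouring values satisfy a Riccati recursion; if the eigenvalue were
  too small, or a ratio well outside \<open>[exp (- G), exp G]\<close>, this recursion would drive a ratio below zero
  within boundedly many steps (\<open>eigenvalue_ge\<close>, \<open>log_ratio_le_G\<close>). Summing the ratio bounds gives
  the lower bound for \<open>w\<close>. For the upper bound, \<open>w\<close> is compared with a strict supersolution built
  from \<open>G\<close> with a factor \<open>\<theta> < 1\<close>: the quotient can be maximal only near \<open>m\<close>
  (\<open>ratio_to_barrier_max\<close>). Together these are \<open>solution_asymptotics\<close>.

  Hence both limits are \<open>- D\<close>, the rate is \<open>2 D\<close>, and the large deviation principle follows since a
  sum of at most \<open>k\<close> terms has the exponential size of its largest term
  (\<open>large_deviation_principle\<close>).
\<close>

section \<open>Periodic functions and hyperbolic cosines\<close>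

lemma periodic_add_int:
  fixes f :: "real \<Rightarrow> 'a"
  assumes "\<And>x. f (x + 1) = f x"
  shows "f (x + of_int n) = f x"
proof -
  have nat: "f (y + real n) = f y" for y and n :: nat
  proof (induction n)
    case (Suc n)
    have "f (y + real (Suc n)) = f ((y + real n) + 1)"
      by (simp add: algebra_simps)
    then show ?case
      using assms Suc by simp
  qed simp
  show ?thesis
  proof (cases "n \<ge> 0")
    case True
    then show ?thesis using nat[of x "nat n"] by simp
  next
    case False
    then show ?thesis using nat[of "x + of_int n" "nat (- n)"] by simp
  qed
qed

lemma periodic_frac:
  fixes f :: "real \<Rightarrow> 'a"
  assumes "\<And>x. f (x + 1) = f x"
  shows "f (frac x) = f x"
  using periodic_add_int[of f x "- \<lfloor>x\<rfloor>"] assms by (simp add: frac_def)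

lemma periodic_uniformly_continuous:
  fixes f :: "real \<Rightarrow> real"
  assumes cont: "continuous_on UNIV f" and per: "\<And>x. f (x + 1) = f x" and "e > 0"
  shows "\<exists>d>0. d \<le> 1 \<and> (\<forall>x y. \<bar>x - y\<bar> < d \<longrightarrow> \<bar>f x - f y\<bar> < e)"
proof -
  have "uniformly_continuous_on {-1..2} f"
    by (intro compact_uniformly_continuous continuous_on_subset[OF cont]) auto
  then obtain d where d: "d > 0"
    "\<And>x y. \<lbrakk>x \<in> {-1..2}; y \<in> {-1..2}; dist y x < d\<rbrakk> \<Longrightarrow> dist (f y) (f x) < e"
    using \<open>e > 0\<close> unfolding uniformly_continuous_on_def by metis
  have "\<bar>f x - f y\<bar> < e" if "\<bar>x - y\<bar> < min d 1" for x y
  proof -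
    have "\<bar>f (x + of_int (- \<lfloor>x\<rfloor>)) - f (y + of_int (- \<lfloor>x\<rfloor>))\<bar> < e"
      using d(2)[of "x - of_int \<lfloor>x\<rfloor>" "y - of_int \<lfloor>x\<rfloor>"] that
      by (simp add: dist_real_def abs_minus_commute) linarith
    then show ?thesis
      by (simp only: periodic_add_int[of f, OF per])
  qed
  then show ?thesis using d(1) by (intro exI[of _ "min d 1"]) auto
qed

lemma two_cosh: "2 * cosh x = exp (- x) + 1 / exp (- x)" for x :: real
proof -
  have "exp x = 1 / exp (- x)" by (metis exp_minus minus_minus inverse_eq_divide)
  then show ?thesis by (simp add: cosh_field_def)
qed

lemma cosh_mult_cosh_le:
  fixes a b :: real
  assumes "0 \<le> a" "0 \<le> b"
  shows "cosh a * cosh b \<le> cosh (a + b)"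
  using assms by (simp add: cosh_add)

lemma sum_inverse_antimono:
  fixes x y :: real
  assumes "0 < x" "x \<le> y" "y \<le> 1"
  shows "y + 1 / y \<le> x + 1 / x"
proof -
  have "0 \<le> (y - x) * (1 - x * y) / (x * y)"
    using assms by (intro divide_nonneg_pos mult_nonneg_nonneg) (auto simp: mult_le_one)
  also have "\<dots> = x + 1 / x - (y + 1 / y)"
    using assms by (simp add: field_simps)
  finally show ?thesis by simp
qed

section \<open>Positive solutions of the periodic difference equation\<close>

text \<open>
  The eigenvector equation of the generator, divided by \<open>k\<close>, for a function on the \<open>k\<close> lattice
  points that is lifted to the universal cover \<open>\<int>\<close>; \<open>r\<close> is the eigenvalue divided by \<open>k\<close>. On \<open>\<int>\<close>
  neighbours need no reduction modulo \<open>k\<close>.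
\<close>

definition periodic_solution :: "(real \<Rightarrow> real) \<Rightarrow> nat \<Rightarrow> real \<Rightarrow> (int \<Rightarrow> real) \<Rightarrow> bool" where
  "periodic_solution V k r w \<longleftrightarrow>
     (\<forall>i. 0 < w i) \<and> (\<forall>i. w (i + int k) = w i) \<and>
     (\<forall>i. w (i + 1) + w (i - 1) = (2 + r - V (of_int i / real k)) * w i)"

lemma periodic_solution_pos: "periodic_solution V k r w \<Longrightarrow> 0 < w i"
  by (simp add: periodic_solution_def)

text \<open>
  The map \<open>R \<mapsto> A - 1 / R\<close> lies at least \<open>c\<close> below the identity on \<open>(0, \<rho>]\<close>, so an orbit that starts
  there descends by \<open>c\<close> at each step and cannot stay positive for more than \<open>\<rho> / c\<close> steps. This
  contradiction excludes small eigenvalues as well as steep ratios.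
\<close>

lemma riccati_descent:
  fixes R :: "nat \<Rightarrow> real"
  assumes pos: "\<And>n. n \<le> N \<Longrightarrow> 0 < R n"
    and step: "\<And>n. n < N \<Longrightarrow> R (Suc n) \<le> A - 1 / R n"
    and start: "R 0 \<le> \<rho>" and c: "0 \<le> c"
    and gap: "\<And>x. \<lbrakk>0 < x; x \<le> \<rho>\<rbrakk> \<Longrightarrow> A + c \<le> x + 1 / x"
    and "n \<le> N"
  shows "R n \<le> \<rho> - real n * c"
  using \<open>n \<le> N\<close>
proof (induction n)
  case (Suc n)
  have "R n \<le> \<rho>" using Suc c by (smt (verit) Suc_leD mult_nonneg_nonneg of_nat_0_le_iff)
  then have "A + c \<le> R n + 1 / R n" using gap pos Suc by simp
  then show ?case using step[of n] Suc by (simp add: algebra_simps)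
qed (use start in simp)

lemma periodic_solution_max:
  assumes "periodic_solution V k r w" "k \<ge> 1"
  obtains j where "a \<le> j" "j < a + int k" "\<And>i. w i \<le> w j"
proof -
  have per: "w (i + n * int k) = w i" for i n
  proof -
    have "w (i + (\<lfloor>x\<rfloor> + 1) * int k) = w (i + \<lfloor>x\<rfloor> * int k)" for x :: real
    proof -
      have "i + (\<lfloor>x\<rfloor> + 1) * int k = (i + \<lfloor>x\<rfloor> * int k) + int k"
        by (simp only: distrib_right mult_1 add.assoc)
      then show ?thesis using assms(1) unfolding periodic_solution_def by metis
    qed
    then show ?thesis
      using periodic_add_int[of "\<lambda>x. w (i + \<lfloor>x\<rfloor> * int k)" 0 n] by simp
  qed
  have ne: "{a..<a + int k} \<noteq> {}" using assms(2) by auto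
  have "Max (w ` {a..<a + int k}) \<in> w ` {a..<a + int k}"
    using ne by (intro Max_in) auto
  then obtain j where j: "j \<in> {a..<a + int k}" "w j = Max (w ` {a..<a + int k})"
    by (smt (verit) imageE)
  have "w i \<le> w j" for i
  proof -
    have "(i - a) mod int k + a \<in> {a..<a + int k}" using assms(2) by simp
    then have "w ((i - a) mod int k + a) \<le> w j" unfolding j(2) by (intro Max_ge) auto
    moreover have "i = (i - a) mod int k + a + ((i - a) div int k) * int k"
      using div_mult_mod_eq[of "i - a" "int k"] by linarith
    ultimately show ?thesis using per by metis
  qed
  then show ?thesis using that j(1) by auto
qed

lemma ratio_recursion:
  assumes "periodic_solution V k r w" "s = 1 \<or> s = -1"
  shows "w (i + s) / w i = 2 + r - V (of_int i / real k) - w (i - s) / w i"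
proof -
  have "w i > 0" and eq: "w (i + 1) + w (i - 1) = (2 + r - V (of_int i / real k)) * w i"
    using assms(1) unfolding periodic_solution_def by auto
  have "w (i + s) + w (i - s) = (2 + r - V (of_int i / real k)) * w i"
    using eq assms(2) by auto
  then have "(w (i + s) + w (i - s)) / w i = 2 + r - V (of_int i / real k)"
    using \<open>w i > 0\<close> by simp
  then show ?thesis by (simp add: add_divide_distrib)
qed

section \<open>Action and distance to the maximum point\<close>

text \<open>
  The maximum point is unique on the circle exactly when it is the only one in \<open>[m, m + 1)\<close>.
\<close>

locale circle_potential =
  fixes V :: "real \<Rightarrow> real" and m :: real
  assumes V_cont: "continuous_on UNIV V"
    and V_periodic: "V (x + 1) = V x"
    and V_le: "V x \<le> V m"
    and V_less: "\<lbrakk>m < x; x < m + 1\<rbrakk> \<Longrightarrow> V x < V m"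
begin

text \<open>
  The nonnegative solution \<open>p\<close> of \<open>2 cosh p - 2 + V x = V m\<close>: the Hamiltonian of the walk at its
  critical energy. It is the exponential growth rate per step of local solutions.
\<close>

definition G :: "real \<Rightarrow> real" where
  "G x = arcosh (1 + (V m - V x) / 2)"

lemma cosh_G: "2 * cosh (G x) = 2 + V m - V x"
  using V_le[of x] unfolding G_def by (subst cosh_arcosh_real) auto

lemma G_nonneg: "0 \<le> G x"
  using V_le[of x] unfolding G_def by (intro arcosh_nonneg_real) auto

lemma G_cont: "continuous_on A G"
  unfolding G_def using V_le
  by (intro continuous_on_arcosh continuous_intros continuous_on_subset[OF V_cont]) auto

lemma G_periodic: "G (x + 1) = G x"
  unfolding G_def by (simp add: V_periodic)

lemma G_pos: "\<lbrakk>m < x; x < m + 1\<rbrakk> \<Longrightarrow> 0 < G x"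
  using V_less[of x] unfolding G_def by (subst arcosh_real_gt_1_iff) auto

text \<open>
  The action: the antiderivative of \<open>G\<close> on the whole line that vanishes at \<open>m\<close>. The action of one
  full turn around the circle is \<open>T\<close>.
\<close>

definition P :: "real \<Rightarrow> real" where
  "P = (SOME F. F m = 0 \<and> (\<forall>x. (F has_real_derivative G x) (at x)))"

lemma P_antiderivative: "P m = 0" "(P has_real_derivative G x) (at x)"
proof -
  have "\<exists>F. \<forall>x. - \<infinity> < ereal x \<longrightarrow> ereal x < \<infinity> \<longrightarrow> (F has_vector_derivative G x) (at x)"
    using G_cont[of UNIV]
    by (intro einterval_antiderivative) (auto simp: continuous_on_eq_continuous_at)
  then obtain F where "\<And>x. (F has_vector_derivative G x) (at x)" by auto
  then have F: "\<And>x. (F has_real_derivative G x) (at x)"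
    by (simp add: has_real_derivative_iff_has_vector_derivative)
  have "(\<lambda>x. F x - F m) m = 0 \<and>
      (\<forall>x. ((\<lambda>x. F x - F m) has_real_derivative G x) (at x))"
    using F by (auto intro!: derivative_eq_intros)
  then have "P m = 0 \<and> (\<forall>x. (P has_real_derivative G x) (at x))"
    unfolding P_def by (rule someI[of "\<lambda>F. F m = 0 \<and> (\<forall>x. (F has_real_derivative G x) (at x))"])
  then show "P m = 0" "(P has_real_derivative G x) (at x)" by auto
qed

lemma P_cont: "continuous_on A P"
  by (rule DERIV_continuous_on, rule has_field_derivative_at_within, rule P_antiderivative(2))

lemma P_mono: "x \<le> y \<Longrightarrow> P x \<le> P y"
  by (rule DERIV_nonneg_imp_nondecreasing) (auto intro: P_antiderivative(2) G_nonneg)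

definition T :: real where "T = P (m + 1)"

text \<open>
  \<open>G\<close> has period 1, so \<open>P (x + 1) - P x\<close> has derivative zero.
\<close>

lemma P_shift: "P (x + 1) = P x + T"
proof -
  have "((\<lambda>x. P (x + 1) - P x) has_real_derivative 0) (at x)" for x
  proof -
    have "((\<lambda>x. P (x + 1)) has_real_derivative G (x + 1) * 1) (at x)"
      by (intro DERIV_chain2[where f = P] P_antiderivative) (auto intro!: derivative_eq_intros)
    then show ?thesis
      using P_antiderivative(2)[of x] by (auto intro!: derivative_eq_intros simp: G_periodic)
  qed
  then have "P (x + 1) - P x = P (m + 1) - P m"
    by (intro DERIV_isconst_all allI)
  then show ?thesis using P_antiderivative(1) by (simp add: T_def)
qed

lemma T_nonneg: "0 \<le> T"
  using P_mono[of m "m + 1"] P_antiderivative(1) by (simp add: T_def)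

lemma P_difference_quotient:
  assumes "e > 0"
  shows "\<exists>d>0. \<forall>x z h. 0 < h \<longrightarrow> h < d \<longrightarrow> x \<le> z \<longrightarrow> z \<le> x + h \<longrightarrow>
           \<bar>(P (x + h) - P x) / h - G z\<bar> < e"
proof -
  obtain d where d: "d > 0" "\<And>x y. \<bar>x - y\<bar> < d \<Longrightarrow> \<bar>G x - G y\<bar> < e"
    using periodic_uniformly_continuous[OF G_cont G_periodic assms] by blast
  have "\<bar>(P (x + h) - P x) / h - G z\<bar> < e"
    if "0 < h" "h < d" "x \<le> z" "z \<le> x + h" for x z h
  proof -
    obtain y where y: "x < y" "y < x + h" "P (x + h) - P x = (x + h - x) * G y"
      using MVT2[of x "x + h" P G] P_antiderivative(2) \<open>0 < h\<close> by auto
    then have "(P (x + h) - P x) / h = G y" using \<open>0 < h\<close> by simp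
    then show ?thesis using d(2)[of y z] y that by auto
  qed
  then show ?thesis using d(1) by blast
qed

text \<open>
  The action needed to get from \<open>m\<close> to \<open>x\<close> on the circle by the cheaper arc: the lifts of \<open>m\<close> are the
  points \<open>m + n\<close>, where \<open>P\<close> has the values \<open>n T\<close>. Written as a distance to a set, it is continuous
  and invariant under \<open>x \<mapsto> x + 1\<close> without a case distinction; \<open>D_eq\<close> gives the two arcs.
\<close>

definition D :: "real \<Rightarrow> real" where
  "D x = infdist (P x) (range (\<lambda>n::int. of_int n * T))"

lemma D_nonneg: "0 \<le> D x"
  unfolding D_def by (rule infdist_nonneg)

lemma D_cont: "continuous_on A D"
  unfolding D_def by (intro continuous_on_infdist P_cont)

lemma D_periodic: "D (x + 1) = D x"
proof -
  have "range (\<lambda>n::int. dist (P x + T) (of_int n * T)) = range (\<lambda>n::int. dist (P x) (of_int n * T))"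
  proof (intro equalityI subsetI; clarify)
    fix n :: int
    show "dist (P x + T) (of_int n * T) \<in> range (\<lambda>n::int. dist (P x) (of_int n * T))"
      by (rule range_eqI[of _ _ "n - 1"]) (simp add: dist_real_def algebra_simps)
    show "dist (P x) (of_int n * T) \<in> range (\<lambda>n::int. dist (P x + T) (of_int n * T))"
      by (rule range_eqI[of _ _ "n + 1"]) (simp add: dist_real_def algebra_simps)
  qed
  then show ?thesis
    by (simp add: D_def P_shift infdist_notempty image_image)
qed

lemma D_eq:
  assumes "m \<le> x" "x \<le> m + 1"
  shows "D x = min (P x) (T - P x)"
proof -
  have p: "0 \<le> P x" "P x \<le> T"
    using P_mono[OF assms(1)] P_mono[OF assms(2)] P_antiderivative(1) by (auto simp: T_def)
  have "D x \<le> dist (P x) (of_int 0 * T)" "D x \<le> dist (P x) (of_int 1 * T)"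
    unfolding D_def by (rule infdist_le, rule rangeI)+
  moreover have "min (P x) (T - P x) \<le> D x"
  proof -
    have "min (P x) (T - P x) \<le> dist (P x) (of_int n * T)" for n :: int
    proof (cases "n \<le> 0")
      case True
      then have "of_int n * T \<le> 0" using T_nonneg by (simp add: mult_nonpos_nonneg)
      then show ?thesis using p by (auto simp: dist_real_def)
    next
      case False
      then have "1 * T \<le> of_int n * T" using T_nonneg by (intro mult_right_mono) auto
      then show ?thesis using p by (auto simp: dist_real_def)
    qed
    then show ?thesis unfolding D_def
      by (subst infdist_notempty) (auto intro!: cINF_greatest)
  qed
  ultimately show ?thesis using p by (auto simp: dist_real_def)
qed

text \<open>
  Away from \<open>m\<close> and \<open>m + 1\<close>, compactness bounds \<open>G\<close> below by a positive constant; this is where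
  the uniqueness of the maximum point enters.
\<close>

lemma D_small_of_G_small:
  assumes "e > 0"
  shows "\<exists>\<eta>>0. \<forall>x. m \<le> x \<longrightarrow> x \<le> m + 1 \<longrightarrow> G x < \<eta> \<longrightarrow> D x < e"
proof -
  obtain d where d: "d > 0" "\<And>x y. \<bar>x - y\<bar> < d \<Longrightarrow> \<bar>D x - D y\<bar> < e"
    using periodic_uniformly_continuous[OF D_cont D_periodic assms] by blast
  have Dm: "D m = 0" "D (m + 1) = 0"
    using D_eq[of m] D_periodic[of m] P_antiderivative(1) T_nonneg by auto
  show ?thesis
  proof (cases "m + d \<le> m + 1 - d")
    case True
    have "\<exists>y\<in>{m + d..m + 1 - d}. \<forall>x\<in>{m + d..m + 1 - d}. G y \<le> G x"
      using True by (intro continuous_attains_inf G_cont) auto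
    then obtain y where y: "y \<in> {m + d..m + 1 - d}"
      "\<And>x. x \<in> {m + d..m + 1 - d} \<Longrightarrow> G y \<le> G x"
      by blast
    have "D x < e" if "m \<le> x" "x \<le> m + 1" "G x < G y" for x
    proof -
      have "\<bar>x - m\<bar> < d \<or> \<bar>x - (m + 1)\<bar> < d" using y(2)[of x] that by force
      then show ?thesis using d(2)[of x m] d(2)[of x "m + 1"] Dm by auto
    qed
    moreover have "G y > 0" using y(1) d(1) by (intro G_pos) auto
    ultimately show ?thesis by blast
  next
    case False
    have "D x < e" if "m \<le> x" "x \<le> m + 1" for x
    proof -
      have "\<bar>x - m\<bar> < d \<or> \<bar>x - (m + 1)\<bar> < d" using False that by linarith
      then show ?thesis using d(2)[of x m] d(2)[of x "m + 1"] Dm by auto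
    qed
    then show ?thesis by (intro exI[of _ 1]) auto
  qed
qed


section \<open>The eigenvalue and the oscillation of solutions\<close>

text \<open>
  At a maximum point of \<open>w\<close> the sum of the neighbouring values is at most twice the value.
\<close>

lemma eigenvalue_le:
  assumes "periodic_solution V k r w" "k \<ge> 1"
  shows "r \<le> V m"
proof -
  obtain j where j: "\<And>i. w i \<le> w j"
    using periodic_solution_max[OF assms] by metis
  have "w j > 0" "(2 + r - V (of_int j / real k)) * w j = w (j + 1) + w (j - 1)"
    using assms(1) unfolding periodic_solution_def by auto
  then have "(2 + r - V (of_int j / real k)) * w j \<le> 2 * w j"
    using j[of "j + 1"] j[of "j - 1"] by linarith
  then have "r \<le> V (of_int j / real k)" using \<open>w j > 0\<close> by simp
  then show ?thesis using V_le order_trans by blast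
qed

lemma V_uniform_on_scale:
  assumes "e > 0"
  shows "\<forall>\<^sub>F k in sequentially. \<forall>x y. \<bar>x - y\<bar> \<le> C / real k \<longrightarrow> \<bar>V x - V y\<bar> < e"
proof -
  obtain d where d: "d > 0" "\<And>x y. \<bar>x - y\<bar> < d \<Longrightarrow> \<bar>V x - V y\<bar> < e"
    using periodic_uniformly_continuous[OF V_cont V_periodic assms] by blast
  have "(\<lambda>k. C / real k) \<longlonglongrightarrow> 0"
    by (intro tendsto_divide_0[OF tendsto_const] filterlim_compose[OF _ filterlim_real_sequentially]
        filterlim_at_top_imp_at_infinity filterlim_ident)
  then have "\<forall>\<^sub>F k in sequentially. C / real k < d" using d(1) order_tendstoD(2) by metis
  then show ?thesis
    by eventually_elim (use d(2) in force)
qed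

text \<open>
  If \<open>w (i + s) / w i\<close> exceeded \<open>exp (G + e)\<close>, then going backwards from \<open>i\<close> the inverse ratios would
  descend as in \<open>riccati_descent\<close>: \<open>exp (- G)\<close> is the lower fixed point of the recursion, and
  from below it the orbit falls past zero. The number of steps needed depends only on \<open>e\<close>, and over boundedly
  many lattice steps \<open>V\<close> is almost constant. The sign \<open>s\<close> treats both directions at once.
\<close>

lemma log_ratio_le_G:
  assumes "e > 0"
  shows "\<forall>\<^sub>F k in sequentially. \<forall>r w i s. periodic_solution V k r w \<longrightarrow> s = 1 \<or> s = -1 \<longrightarrow>
           ln (w (i + s)) - ln (w i) \<le> G (of_int i / real k) + e"
proof -
  \<comment> \<open>For \<open>x \<le> exp (- (g + e))\<close> the value of \<open>x + 1 / x\<close> exceeds \<open>2 cosh g\<close> by at least \<open>2 (cosh e - 1)\<close>: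
    one half is the descent per step, the other absorbs the variation of \<open>V\<close>.\<close>
  define c where "c = cosh e - 1"
  have c: "c > 0" using assms cosh_real_strict_mono[of 0 e] by (simp add: c_def)
  obtain N where N: "1 < real N * c" using reals_Archimedean3[OF c] by blast
  have "\<forall>\<^sub>F k in sequentially. \<forall>x y. \<bar>x - y\<bar> \<le> real N / real k \<longrightarrow> \<bar>V x - V y\<bar> < c"
    by (rule V_uniform_on_scale[OF c])
  then show ?thesis using eventually_ge_at_top[of 1]
  proof eventually_elim
    case (elim k)
    show ?case
    proof (intro allI impI)
      fix r w i s
      assume sol: "periodic_solution V k r w" and s: "s = (1::int) \<or> s = -1"
      have pos: "\<And>i. 0 < w i" using sol by (rule periodic_solution_pos)
      define g where "g = G (of_int i / real k)"
      show "ln (w (i + s)) - ln (w i) \<le> G (of_int i / real k) + e"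
      proof (rule ccontr)
        assume neg: "\<not> ?thesis"
        define R where "R n = w (i - s * int n) / w (i - s * int n + s)" for n
        have "ln (R 0) < ln (exp (- (g + e)))"
          using neg pos[of i] pos[of "i + s"] by (simp add: R_def g_def ln_div)
        then have start: "R 0 \<le> exp (- (g + e))"
          using pos by (subst (asm) ln_less_cancel_iff) (auto simp: R_def)
        have "R N \<le> exp (- (g + e)) - real N * c"
        proof (rule riccati_descent[where N = N and A = "2 * cosh g + c"])
          fix n assume "n < N"
          let ?j = "i - s * int n"
          have "\<bar>of_int ?j / real k - of_int i / real k\<bar> \<le> real N / real k"
            using \<open>n < N\<close> s elim(2) by (auto simp: diff_divide_distrib[symmetric] divide_right_mono)
          then have "\<bar>V (of_int ?j / real k) - V (of_int i / real k)\<bar> < c" using elim(1) by blast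
          moreover have "r \<le> V m" using eigenvalue_le[OF sol elim(2)] .
          moreover have "R (Suc n) = 2 + r - V (of_int ?j / real k) - 1 / R n"
            using ratio_recursion[OF sol, of "- s" ?j] s
            by (auto simp: R_def algebra_simps)
          ultimately show "R (Suc n) \<le> 2 * cosh g + c - 1 / R n"
            unfolding g_def cosh_G by linarith
        next
          fix x :: real assume x: "0 < x" "x \<le> exp (- (g + e))"
          have ge: "0 \<le> g" using G_nonneg by (simp add: g_def)
          have "2 * cosh g + c + c \<le> 2 * (cosh g * cosh e)"
          proof -
            have "0 \<le> (cosh g - 1) * (cosh e - 1)"
              using c cosh_real_ge_1[of g] by (intro mult_nonneg_nonneg) (auto simp: c_def)
            then show ?thesis by (simp add: c_def algebra_simps)
          qed
          also have "\<dots> \<le> 2 * cosh (g + e)" using cosh_mult_cosh_le[OF ge] assms by simp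
          also have "\<dots> = exp (- (g + e)) + 1 / exp (- (g + e))"
            by (rule two_cosh)
          also have "\<dots> \<le> x + 1 / x" using x ge assms by (intro sum_inverse_antimono) auto
          finally show "2 * cosh g + c + c \<le> x + 1 / x" .
        qed (use pos start c in \<open>auto simp: R_def\<close>)
        moreover have "R N > 0" using pos by (simp add: R_def)
        moreover have "exp (- (g + e)) \<le> 1" using G_nonneg[of "of_int i / real k"] assms by (simp add: g_def)
        ultimately show False using N by linarith
      qed
    qed
  qed
qed

text \<open>
  Near \<open>m\<close> a smaller eigenvalue makes the coefficient of the equation at most \<open>2 - e / 2\<close>. Since
  \<open>x + 1 / x \<ge> 2\<close>, all ratios then descend: \<open>w\<close> would oscillate and change sign.
\<close>

lemma eigenvalue_ge:
  assumes "e > 0"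
  shows "\<forall>\<^sub>F k in sequentially. \<forall>r w. periodic_solution V k r w \<longrightarrow> V m - e \<le> r"
proof -
  define c where "c = e / 2"
  have c: "c > 0" using assms by (simp add: c_def)
  obtain N where N: "2 < real N * c" using reals_Archimedean3[OF c] by blast
  have "\<forall>\<^sub>F k in sequentially. \<forall>x y. \<bar>x - y\<bar> \<le> real (N + 2) / real k \<longrightarrow> \<bar>V x - V y\<bar> < c"
    by (rule V_uniform_on_scale[OF c])
  then show ?thesis using eventually_ge_at_top[of 1]
  proof eventually_elim
    case (elim k)
    show ?case
    proof (intro allI impI)
      fix r w
      assume sol: "periodic_solution V k r w"
      have pos: "\<And>i. 0 < w i" using sol by (rule periodic_solution_pos)
      define j where "j = \<lfloor>m * real k\<rfloor>"
      show "V m - e \<le> r"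
      proof (rule ccontr)
        assume neg: "\<not> ?thesis"
        define R where "R n = w (j + int n + 1) / w (j + int n)" for n
        have step: "R (Suc n) \<le> 2 - c - 1 / R n" if "n \<le> N" for n
        proof -
          let ?j = "j + int (Suc n)"
          have "\<bar>of_int ?j - m * real k\<bar> \<le> real (N + 2)"
            using that unfolding j_def by (simp, linarith)
          then have "\<bar>of_int ?j - m * real k\<bar> / real k \<le> real (N + 2) / real k"
            by (rule divide_right_mono) simp
          moreover have "\<bar>of_int ?j - m * real k\<bar> / real k = \<bar>of_int ?j / real k - m\<bar>"
            using elim(2) by (simp add: field_simps flip: abs_divide) (simp add: abs_divide)
          ultimately have "\<bar>V (of_int ?j / real k) - V m\<bar> < c" using elim(1) by metis
          moreover have "R (Suc n) = 2 + r - V (of_int ?j / real k) - 1 / R n"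
            using ratio_recursion[OF sol, of 1 ?j] by (auto simp: R_def algebra_simps)
          ultimately show ?thesis using neg c_def by linarith
        qed
        \<comment> \<open>The first ratio \<open>R 0\<close> has no a priori bound, but \<open>R 1 \<le> 2\<close>; so the descent starts at index 1.\<close>
        have "R (Suc N) \<le> 2 - real N * c"
        proof (rule riccati_descent[where N = N and A = "2 - c" and R = "\<lambda>n. R (Suc n)"])
          have "0 < 1 / R 0" using pos by (simp add: R_def)
          then show "R (Suc 0) \<le> 2" using step[of 0] c by linarith
        next
          fix x :: real assume "0 < x"
          have "0 \<le> (x - 1)\<^sup>2 / x" using \<open>0 < x\<close> by simp
          also have "\<dots> = x + 1 / x - 2" using \<open>0 < x\<close> by (simp add: field_simps power2_eq_square)
          finally show "2 - c + c \<le> x + 1 / x" by simp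
        next
          fix n assume "n < N"
          then show "R (Suc (Suc n)) \<le> 2 - c - 1 / R (Suc n)" using step[of "Suc n"] by simp
        qed (use pos c in \<open>auto simp: R_def\<close>)
        moreover have "R (Suc N) > 0" using pos by (simp add: R_def)
        ultimately show False using N by linarith
      qed
    qed
  qed
qed

lemma P_lattice_increment:
  assumes "e > 0"
  shows "\<forall>\<^sub>F k in sequentially. \<forall>i::int.
           \<bar>real k * (P (of_int (i + 1) / real k) - P (of_int i / real k))
              - G (of_int i / real k)\<bar> < e \<and>
           \<bar>real k * (P (of_int (i + 1) / real k) - P (of_int i / real k))
              - G (of_int (i + 1) / real k)\<bar> < e"
proof -
  obtain d where d: "d > 0" "\<And>x z h. \<lbrakk>0 < h; h < d; x \<le> z; z \<le> x + h\<rbrakk> \<Longrightarrow>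
      \<bar>(P (x + h) - P x) / h - G z\<bar> < e"
    using P_difference_quotient[OF assms] by blast
  have "(\<lambda>k. 1 / real k) \<longlonglongrightarrow> 0" by (rule lim_1_over_n)
  then have "\<forall>\<^sub>F k in sequentially. 1 / real k < d" using d(1) order_tendstoD(2) by metis
  then show ?thesis using eventually_ge_at_top[of 1]
  proof eventually_elim
    case (elim k)
    show ?case
    proof
      fix i :: int
      have "of_int (i + 1) / real k = of_int i / real k + 1 / real k"
        by (simp add: add_divide_distrib)
      then show "\<bar>real k * (P (of_int (i + 1) / real k) - P (of_int i / real k))
              - G (of_int i / real k)\<bar> < e \<and>
           \<bar>real k * (P (of_int (i + 1) / real k) - P (of_int i / real k))
              - G (of_int (i + 1) / real k)\<bar> < e"
        using elim d(2)[of "1 / real k" "of_int i / real k" "of_int i / real k"]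
          d(2)[of "1 / real k" "of_int i / real k" "of_int i / real k + 1 / real k"]
        by (simp add: mult.commute)
    qed
  qed
qed

text \<open>
  Both one-step bounds hold with \<open>G\<close> replaced by \<open>k\<close> times an increment of \<open>P\<close>, and these increments
  telescope.
\<close>

lemma log_oscillation:
  assumes "e > 0"
  shows "\<forall>\<^sub>F k in sequentially. \<forall>r w i j. periodic_solution V k r w \<longrightarrow>
           \<bar>ln (w i) - ln (w j)\<bar> \<le>
             real k * \<bar>P (of_int i / real k) - P (of_int j / real k)\<bar> + e * of_int \<bar>i - j\<bar>"
proof -
  have "e / 2 > 0" using assms by simp
  from log_ratio_le_G[OF this] P_lattice_increment[OF this] show ?thesis
  proof eventually_elim
    case (elim k)
    show ?case
    proof (intro allI impI)
      fix r w i j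
      assume sol: "periodic_solution V k r w"
      define p where "p i = real k * P (of_int i / real k)" for i :: int
      have step: "\<bar>ln (w (i + 1)) - ln (w i)\<bar> \<le> p (i + 1) - p i + e" for i
      proof -
        have "ln (w (i + 1)) - ln (w i) \<le> G (of_int i / real k) + e / 2"
          using elim(1) sol by blast
        moreover have "ln (w i) - ln (w (i + 1)) \<le> G (of_int (i + 1) / real k) + e / 2"
          using elim(1)[rule_format, OF sol, of "-1" "i + 1"] by simp
        ultimately show ?thesis using spec[OF elim(2), of i]
          unfolding p_def right_diff_distrib[symmetric] by linarith
      qed
      have chain: "\<bar>ln (w (i + int n)) - ln (w i)\<bar> \<le> p (i + int n) - p i + e * real n" for i n
      proof (induction n)
        case (Suc n)
        have "i + int (Suc n) = i + int n + 1" by simp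
        then have "\<bar>ln (w (i + int (Suc n))) - ln (w (i + int n))\<bar> \<le> p (i + int (Suc n)) - p (i + int n) + e"
          using step by metis
        moreover have "e * real (Suc n) = e * real n + e" by (simp add: algebra_simps)
        ultimately show ?case using Suc by linarith
      qed simp
      have pp: "p i - p j \<le> real k * \<bar>P (of_int i / real k) - P (of_int j / real k)\<bar>" for i j
        unfolding p_def right_diff_distrib[symmetric] by (intro mult_left_mono) auto
      have *: "\<bar>ln (w i) - ln (w j)\<bar> \<le>
             real k * \<bar>P (of_int i / real k) - P (of_int j / real k)\<bar> + e * of_int \<bar>i - j\<bar>"
        if "j \<le> i" for i j
        using chain[of j "nat (i - j)"] pp[of i j] that by simp
      show "\<bar>ln (w i) - ln (w j)\<bar> \<le>
             real k * \<bar>P (of_int i / real k) - P (of_int j / real k)\<bar> + e * of_int \<bar>i - j\<bar>"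
        using *[of i j] *[of j i] by (cases "j \<le> i") (auto simp: abs_minus_commute)
    qed
  qed
qed


section \<open>Decay of solutions by comparison with a barrier\<close>

text \<open>
  Where \<open>G x \<ge> \<eta>\<close>, replacing \<open>G\<close> by \<open>\<theta> G\<close> divides \<open>cosh G\<close> by at least \<open>cosh ((1 - \<theta>) \<eta>) > 1\<close>,
  which small errors cannot compensate.
\<close>

lemma comparison_gap:
  assumes \<theta>: "0 < \<theta>" "\<theta> < 1" and "\<eta> > 0"
  shows "\<exists>e>0. \<forall>x. 2 * cosh (G x) - e \<le> exp e * (2 * cosh (\<theta> * G x)) \<longrightarrow> G x < \<eta>"
proof -
  define s where "s = (1 - \<theta>) * \<eta>"
  have s: "s > 0" using assms by (simp add: s_def)
  have cs: "1 < cosh s" using s cosh_real_strict_mono[of 0 s] by simp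
  have "((\<lambda>e. exp e + e) \<longlongrightarrow> exp 0 + 0) (at_right (0::real))"
    by (intro tendsto_intros)
  then have "\<forall>\<^sub>F e in at_right (0::real). exp e + e < cosh s"
    using order_tendstoD(2) cs by fastforce
  then have "\<forall>\<^sub>F e in at_right (0::real). exp e + e < cosh s \<and> e > 0"
    using eventually_at_right_less[of 0] by eventually_elim auto
  then obtain e where e: "exp e + e < cosh s" "(e::real) > 0"
    using eventually_happens[of _ "at_right (0::real)"] by auto
  have "G x < \<eta>" if le: "2 * cosh (G x) - e \<le> exp e * (2 * cosh (\<theta> * G x))" for x
  proof (rule ccontr)
    assume "\<not> ?thesis"
    then have "s \<le> (1 - \<theta>) * G x" using \<theta> by (auto simp: s_def intro: mult_left_mono)
    then have le2: "\<theta> * G x + s \<le> G x" by (simp add: algebra_simps)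
    have nn: "0 \<le> \<theta> * G x" using \<theta> G_nonneg by simp
    have "cosh (\<theta> * G x) * (exp e + e) < cosh (\<theta> * G x) * cosh s"
      using e(1) by (intro mult_strict_left_mono) auto
    also have "\<dots> \<le> cosh (\<theta> * G x + s)" using nn s by (intro cosh_mult_cosh_le) auto
    also have "\<dots> \<le> cosh (G x)" using le2 nn s by (subst cosh_real_nonneg_le_iff) auto
    finally have "cosh (\<theta> * G x) * exp e + cosh (\<theta> * G x) * e < cosh (G x)"
      by (simp add: algebra_simps)
    moreover have "1 * e \<le> cosh (\<theta> * G x) * e"
      using e(2) cosh_real_ge_1 by (intro mult_right_mono) auto
    moreover have "exp e * (2 * cosh (\<theta> * G x)) = 2 * (cosh (\<theta> * G x) * exp e)" by simp
    ultimately show False using le e(2) by linarith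
  qed
  then show ?thesis using e(2) by blast
qed

text \<open>
  The sum of the two decaying WKB exponentials that start at \<open>m\<close> and at \<open>m + 1\<close>, with their rates
  reduced by \<open>\<theta>\<close>. It is comparable to \<open>exp (- \<theta> k D)\<close> on \<open>[m, m + 1]\<close>.
\<close>

definition barrier :: "real \<Rightarrow> nat \<Rightarrow> int \<Rightarrow> real" where
  "barrier \<theta> k i = exp (- (\<theta> * real k * P (of_int i / real k)))
     + exp (- (\<theta> * real k * (T - P (of_int i / real k))))"

lemma barrier_pos: "0 < barrier \<theta> k i"
  unfolding barrier_def by (intro add_pos_pos) auto

lemma barrier_supersolution:
  assumes \<theta>: "0 < \<theta>" "\<theta> < 1" and "e > 0"
  shows "\<forall>\<^sub>F k in sequentially. \<forall>i. barrier \<theta> k (i + 1) + barrier \<theta> k (i - 1)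
           \<le> exp e * (2 * cosh (\<theta> * G (of_int i / real k))) * barrier \<theta> k i"
  using P_lattice_increment[OF \<open>e > 0\<close>]
proof eventually_elim
  case (elim k)
  show ?case
  proof
    fix i :: int
    define g where "g = G (of_int i / real k)"
    define p where "p = (\<lambda>i::int. real k * P (of_int i / real k))"
    have inc: "\<bar>p (i + 1) - p i - g\<bar> < e" "\<bar>p i - p (i - 1) - g\<bar> < e"
      using spec[OF elim, of i] spec[OF elim, of "i - 1"]
      unfolding p_def g_def right_diff_distrib[symmetric] by auto
    have *: "exp (\<theta> * x) \<le> exp e * exp (\<theta> * y)" if "x < y + e" for x y
    proof -
      have "\<theta> * x \<le> \<theta> * (y + e)" using that \<theta> by (intro mult_left_mono) auto
      also have "\<dots> \<le> \<theta> * y + e"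
        using \<theta> \<open>e > 0\<close> by (simp add: distrib_left mult_left_le_one_le)
      finally show ?thesis by (simp add: exp_add[symmetric] add.commute)
    qed
    \<comment> \<open>The barrier is expanded around \<open>i\<close>: each of its two exponentials is multiplicative in the
      increments of \<open>p\<close>, and these are \<open>\<plusminus> g\<close> up to \<open>e\<close>.\<close>
    define a where "a = exp (- (\<theta> * p i))"
    define b where "b = exp (- (\<theta> * (real k * T - p i)))"
    have bar: "barrier \<theta> k j = a * exp (\<theta> * (p i - p j)) + b * exp (\<theta> * (p j - p i))" for j
      by (simp add: barrier_def a_def b_def p_def exp_add[symmetric] algebra_simps)
    have "barrier \<theta> k (i + 1) + barrier \<theta> k (i - 1) =
        a * (exp (\<theta> * (p i - p (i + 1))) + exp (\<theta> * (p i - p (i - 1)))) +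
        b * (exp (\<theta> * (p (i + 1) - p i)) + exp (\<theta> * (p (i - 1) - p i)))"
      unfolding bar by (simp add: algebra_simps)
    also have "\<dots> \<le> a * (exp e * exp (\<theta> * (- g)) + exp e * exp (\<theta> * g)) +
        b * (exp e * exp (\<theta> * g) + exp e * exp (\<theta> * (- g)))"
      using inc by (intro add_mono mult_left_mono *) (auto simp: a_def b_def)
    also have "\<dots> = exp e * (2 * cosh (\<theta> * g)) * (a + b)"
      by (simp add: cosh_field_def algebra_simps)
    also have "a + b = barrier \<theta> k i" unfolding bar by simp
    finally show "barrier \<theta> k (i + 1) + barrier \<theta> k (i - 1)
           \<le> exp e * (2 * cosh (\<theta> * G (of_int i / real k))) * barrier \<theta> k i"
      unfolding g_def .
  qed
qed

lemma D_near_maximum: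
  assumes "e > 0"
  shows "\<forall>\<^sub>F k in sequentially. \<forall>x. \<bar>x - m\<bar> \<le> 1 / real k \<or> \<bar>x - (m + 1)\<bar> \<le> 1 / real k \<longrightarrow> D x < e"
proof -
  obtain d where d: "d > 0" "\<And>x y. \<bar>x - y\<bar> < d \<Longrightarrow> \<bar>D x - D y\<bar> < e"
    using periodic_uniformly_continuous[OF D_cont D_periodic assms] by blast
  have Dm: "D m = 0" "D (m + 1) = 0"
    using D_eq[of m] D_periodic[of m] P_antiderivative(1) T_nonneg by auto
  have "\<forall>\<^sub>F k in sequentially. 1 / real k < d"
    using order_tendstoD(2)[OF lim_1_over_n d(1)] .
  then show ?thesis
  proof eventually_elim
    case (elim k)
    show ?case
    proof (intro allI impI)
      fix x assume "\<bar>x - m\<bar> \<le> 1 / real k \<or> \<bar>x - (m + 1)\<bar> \<le> 1 / real k"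
      then have "\<bar>x - m\<bar> < d \<or> \<bar>x - (m + 1)\<bar> < d" using elim by linarith
      then show "D x < e" using d(2)[of x m] d(2)[of x "m + 1"] Dm by auto
    qed
  qed
qed

definition window :: "nat \<Rightarrow> int set" where
  "window k = {i. m \<le> of_int i / real k \<and> of_int i / real k \<le> m + 1}"

lemma window_eq:
  assumes "k \<ge> 1"
  shows "window k = {\<lceil>m * real k\<rceil>..\<lfloor>m * real k + real k\<rfloor>}"
  using assms by (auto simp: window_def ceiling_le_iff le_floor_iff pos_le_divide_eq
      pos_divide_le_eq algebra_simps) linarith+

lemma window_cover:
  assumes "k \<ge> 1" "\<lceil>m * real k\<rceil> \<le> i" "i < \<lceil>m * real k\<rceil> + int k"
  shows "i \<in> window k"
  using assms unfolding window_eq[OF assms(1)] by (simp add: le_floor_iff) linarith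

text \<open>
  At an interior maximum point \<open>j\<close> of the quotient, the equation for \<open>w\<close> and the inequality for the
  barrier give \<open>2 + r - V \<le> exp e * 2 cosh (\<theta> G)\<close> at \<open>j / k\<close>. As \<open>r\<close> is almost \<open>V m\<close>, the left side
  is almost \<open>2 cosh G\<close>, so \<open>G\<close> is small there and \<open>j / k\<close> is near \<open>m\<close>. At the ends of the window
  this is immediate.
\<close>

lemma ratio_to_barrier_max:
  assumes "0 < \<theta>" "\<theta> < 1" "\<epsilon> > 0"
  shows "\<forall>\<^sub>F k in sequentially. \<forall>r w. periodic_solution V k r w \<longrightarrow>
      (\<exists>j \<in> window k. D (of_int j / real k) < \<epsilon> \<and>
        (\<forall>i \<in> window k. w i / barrier \<theta> k i \<le> w j / barrier \<theta> k j))"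
proof -
  obtain \<eta> where \<eta>: "\<eta> > 0" "\<And>x. \<lbrakk>m \<le> x; x \<le> m + 1; G x < \<eta>\<rbrakk> \<Longrightarrow> D x < \<epsilon>"
    using D_small_of_G_small[OF assms(3)] by blast
  obtain e where e: "e > 0"
    "\<And>x. 2 * cosh (G x) - e \<le> exp e * (2 * cosh (\<theta> * G x)) \<Longrightarrow> G x < \<eta>"
    using comparison_gap[OF assms(1,2) \<eta>(1)] by blast
  from barrier_supersolution[OF assms(1,2) e(1)] eigenvalue_ge[OF e(1)] D_near_maximum[OF assms(3)]
    eventually_ge_at_top[of 1]
  show ?thesis
  proof eventually_elim
    case (elim k)
    show ?case
    proof (intro allI impI)
      fix r w assume sol: "periodic_solution V k r w"
      have pos: "\<And>i. 0 < w i" using sol by (rule periodic_solution_pos)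
      let ?q = "\<lambda>i. w i / barrier \<theta> k i"
      have fin: "finite (window k)" using window_eq[OF elim(4)] by simp
      have ne: "window k \<noteq> {}" using window_cover[OF elim(4), of "\<lceil>m * real k\<rceil>"] elim(4) by auto
      have "Max (?q ` window k) \<in> ?q ` window k" using fin ne by (intro Max_in) auto
      then obtain j where j: "j \<in> window k" "?q j = Max (?q ` window k)"
        by (smt (verit) imageE)
      have max: "?q i \<le> ?q j" if "i \<in> window k" for i
        unfolding j(2) using fin that by (intro Max_ge) auto
      have "D (of_int j / real k) < \<epsilon>"
      proof (cases "j + 1 \<in> window k \<and> j - 1 \<in> window k")
        case True
        define q where "q = ?q j"
        have wq: "w i \<le> q * barrier \<theta> k i" if "i \<in> window k" for i
          using max[OF that] barrier_pos[of \<theta> k i] by (simp add: q_def pos_divide_le_eq)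
        have q0: "0 \<le> q" using pos[of j] barrier_pos[of \<theta> k j] by (simp add: q_def)
        have wj: "w j = q * barrier \<theta> k j" using barrier_pos[of \<theta> k j] by (simp add: q_def)
        let ?x = "of_int j / real k"
        have "(2 + r - V ?x) * w j = w (j + 1) + w (j - 1)"
          using sol unfolding periodic_solution_def by simp
        also have "\<dots> \<le> q * barrier \<theta> k (j + 1) + q * barrier \<theta> k (j - 1)"
          using True wq by (intro add_mono) auto
        also have "\<dots> = q * (barrier \<theta> k (j + 1) + barrier \<theta> k (j - 1))"
          by (simp add: distrib_left)
        also have "\<dots> \<le> q * (exp e * (2 * cosh (\<theta> * G ?x)) * barrier \<theta> k j)"
          using elim(1) q0 by (intro mult_left_mono) auto
        also have "\<dots> = exp e * (2 * cosh (\<theta> * G ?x)) * w j" by (simp add: wj)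
        finally have "2 + r - V ?x \<le> exp e * (2 * cosh (\<theta> * G ?x))"
          using pos[of j] by (rule mult_right_le_imp_le)
        moreover have "V m - e \<le> r" using elim(2) sol by blast
        ultimately have "2 * cosh (G ?x) - e \<le> exp e * (2 * cosh (\<theta> * G ?x))"
          unfolding cosh_G by linarith
        then have "G ?x < \<eta>" by (rule e(2))
        then show ?thesis using \<eta>(2) j(1) by (auto simp: window_def)
      next
        case False
        have "\<bar>of_int j / real k - m\<bar> \<le> 1 / real k \<or> \<bar>of_int j / real k - (m + 1)\<bar> \<le> 1 / real k"
        proof -
          have "m \<le> of_int j / real k" "of_int j / real k \<le> m + 1" "0 \<le> 1 / real k"
            using j(1) by (auto simp: window_def)
          moreover have "\<not> (of_int j / real k + 1 / real k \<le> m + 1 \<and> m \<le> of_int j / real k + 1 / real k \<and>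
              of_int j / real k - 1 / real k \<le> m + 1 \<and> m \<le> of_int j / real k - 1 / real k)"
            using False by (simp add: window_def add_divide_distrib diff_divide_distrib) blast
          ultimately show ?thesis by linarith
        qed
        then show ?thesis using elim(3) by blast
      qed
      then show "\<exists>j \<in> window k. D (of_int j / real k) < \<epsilon> \<and>
        (\<forall>i \<in> window k. w i / barrier \<theta> k i \<le> w j / barrier \<theta> k j)"
        using j(1) max by blast
    qed
  qed
qed

text \<open>
  At the maximum point \<open>j\<close> of the quotient the barrier is almost 1 at exponential scale, so the
  quotient there is at most about \<open>w j\<close>. The tolerance \<open>\<epsilon>\<close> is spent in three parts: the value of
  the barrier at \<open>j\<close>, the loss from \<open>\<theta>\<close>, and the factor 2 from the two exponentials.
\<close>

lemma solution_upper_bound: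
  assumes "\<epsilon> > 0"
  shows "\<forall>\<^sub>F k in sequentially. \<forall>r w. periodic_solution V k r w \<longrightarrow>
      (\<exists>j. \<forall>i \<in> window k. ln (w i) \<le> ln (w j) - real k * D (of_int i / real k) + real k * \<epsilon>)"
proof -
  define \<delta> where "\<delta> = \<epsilon> / 3"
  have \<delta>: "\<delta> > 0" using assms by (simp add: \<delta>_def)
  define \<theta> where "\<theta> = 1 - min (1/2) (\<delta> / (T + 1))"
  have \<theta>: "0 < \<theta>" "\<theta> < 1" using \<delta> T_nonneg by (auto simp: \<theta>_def min_def field_simps)
  have \<theta>T: "(1 - \<theta>) * T \<le> \<delta>"
  proof -
    have "(1 - \<theta>) * T \<le> \<delta> / (T + 1) * T"
      using T_nonneg by (intro mult_right_mono) (auto simp: \<theta>_def)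
    also have "\<dots> \<le> \<delta>" using T_nonneg \<delta> by (simp add: field_simps)
    finally show ?thesis .
  qed
  have "(\<lambda>k. ln 2 / real k) \<longlonglongrightarrow> 0"
    by (rule lim_const_over_n)
  then have "\<forall>\<^sub>F k in sequentially. ln 2 / real k < \<delta>" using order_tendstoD(2) \<delta> by metis
  then show ?thesis using ratio_to_barrier_max[OF \<theta> \<delta>] eventually_ge_at_top[of 1]
  proof eventually_elim
    case (elim k)
    show ?case
    proof (intro allI impI)
      fix r w assume sol: "periodic_solution V k r w"
      have pos: "\<And>i. 0 < w i" using sol by (rule periodic_solution_pos)
      obtain j where j: "j \<in> window k" "D (of_int j / real k) < \<delta>"
        "\<And>i. i \<in> window k \<Longrightarrow> w i / barrier \<theta> k i \<le> w j / barrier \<theta> k j"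
        using elim(2) sol by blast
      have ln2: "ln 2 \<le> real k * \<delta>" using elim(1,3) by (simp add: field_simps)
      have "ln (w i) \<le> ln (w j) - real k * D (of_int i / real k) + real k * \<epsilon>"
        if i: "i \<in> window k" for i
      proof -
        have Deq: "D (of_int l / real k) = min (P (of_int l / real k)) (T - P (of_int l / real k))"
          if "l \<in> window k" for l
          using that by (intro D_eq) (auto simp: window_def)
        have nz: "w l \<noteq> 0" "barrier \<theta> k l \<noteq> 0" for l
          using pos[of l] barrier_pos[of \<theta> k l] by auto
        have "ln (w i / barrier \<theta> k i) \<le> ln (w j / barrier \<theta> k j)"
          using j(3)[OF i] pos barrier_pos by (subst ln_le_cancel_iff) auto
        then have le: "ln (w i) - ln (barrier \<theta> k i) \<le> ln (w j) - ln (barrier \<theta> k j)"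
          using nz by (simp add: ln_div)
        have "exp (- (\<theta> * real k * D (of_int j / real k))) \<le> barrier \<theta> k j"
          unfolding barrier_def Deq[OF j(1)] by (auto simp: min_def)
        then have "- (\<theta> * real k * D (of_int j / real k)) \<le> ln (barrier \<theta> k j)"
          using barrier_pos by (simp add: ln_ge_iff)
        moreover have "\<theta> * real k * D (of_int j / real k) \<le> 1 * real k * \<delta>"
          using \<theta> j(2) D_nonneg by (intro mult_mono) auto
        ultimately have lower: "- (real k * \<delta>) \<le> ln (barrier \<theta> k j)" by simp
        have "barrier \<theta> k i \<le> exp (- (\<theta> * real k * D (of_int i / real k)))
            + exp (- (\<theta> * real k * D (of_int i / real k)))"
          unfolding barrier_def Deq[OF i] using \<theta> by (intro add_mono) (auto intro!: mult_left_mono)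
        then have "ln (barrier \<theta> k i) \<le> ln (2 * exp (- (\<theta> * real k * D (of_int i / real k))))"
          using barrier_pos by (subst ln_le_cancel_iff) auto
        then have upper: "ln (barrier \<theta> k i) \<le> ln 2 - \<theta> * real k * D (of_int i / real k)"
          by (simp add: ln_mult)
        have "D (of_int i / real k) \<le> T"
          unfolding Deq[OF i] using T_nonneg by linarith
        then have "(1 - \<theta>) * D (of_int i / real k) \<le> (1 - \<theta>) * T"
          using \<theta> by (intro mult_left_mono) auto
        then have "real k * ((1 - \<theta>) * D (of_int i / real k)) \<le> real k * \<delta>"
          using \<theta>T by (intro mult_left_mono) auto
        then have "real k * D (of_int i / real k) - real k * \<delta> \<le> \<theta> * real k * D (of_int i / real k)"
          by (simp add: algebra_simps)
        then show ?thesis using le lower upper ln2 unfolding \<delta>_def by simp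
      qed
      then show "\<exists>j. \<forall>i \<in> window k.
          ln (w i) \<le> ln (w j) - real k * D (of_int i / real k) + real k * \<epsilon>" by blast
    qed
  qed
qed

text \<open>
  The upper bound, applied at the maximum point \<open>j\<close> of \<open>w\<close> itself, forces \<open>D (j / k)\<close> to be small;
  the oscillation bound from there gives the lower bound.
\<close>

lemma solution_asymptotics:
  assumes "\<epsilon> > 0"
  shows "\<forall>\<^sub>F k in sequentially. \<forall>r w. periodic_solution V k r w \<longrightarrow>
      (\<exists>j. (\<forall>i. w i \<le> w j) \<and>
        (\<forall>i \<in> window k. \<bar>1 / real k * (ln (w i) - ln (w j)) + D (of_int i / real k)\<bar> \<le> \<epsilon>))"
proof -
  define \<delta> where "\<delta> = \<epsilon> / 4"
  have \<delta>: "\<delta> > 0" using assms by (simp add: \<delta>_def)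
  from solution_upper_bound[OF \<delta>] log_oscillation[OF \<delta>] eventually_ge_at_top[of 1]
  show ?thesis
  proof eventually_elim
    case (elim k)
    show ?case
    proof (intro allI impI)
      fix r w assume sol: "periodic_solution V k r w"
      have pos: "\<And>i. 0 < w i" using sol by (rule periodic_solution_pos)
      obtain j where j0: "\<lceil>m * real k\<rceil> \<le> j" "j < \<lceil>m * real k\<rceil> + int k" and max: "\<And>i. w i \<le> w j"
        using periodic_solution_max[OF sol elim(3)] by metis
      have j: "j \<in> window k" using window_cover[OF elim(3) j0] .
      obtain j' where j': "\<And>i. i \<in> window k \<Longrightarrow>
          ln (w i) \<le> ln (w j') - real k * D (of_int i / real k) + real k * \<delta>"
        using elim(1) sol by blast
      have upper: "ln (w i) \<le> ln (w j) - real k * D (of_int i / real k) + real k * \<delta>"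
        if "i \<in> window k" for i
        using j'[OF that] max[of j'] pos by (smt (verit) ln_le_cancel_iff)
      have k: "real k > 0" using elim(3) by simp
      have "real k * D (of_int j / real k) \<le> real k * \<delta>" using upper[OF j] by simp
      then have Dj: "D (of_int j / real k) \<le> \<delta>" using k by simp
      define p where "p i = P (of_int i / real k)" for i :: int
      have p_shift: "p (i + int k) = p i + T" for i
        using P_shift[of "of_int i / real k"] k by (simp add: p_def add_divide_distrib)
      have w_shift: "w (i + int k) = w i" for i
        using sol by (simp add: periodic_solution_def)
      have Deq: "D (of_int l / real k) = min (p l) (T - p l)" "0 \<le> p l" "p l \<le> T"
        if "l \<in> window k" for l
        using that D_eq[of "of_int l / real k"] P_mono[of m "of_int l / real k"]
          P_mono[of "of_int l / real k" "m + 1"] P_antiderivative(1)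
        by (auto simp: window_def p_def T_def)
      have lower: "ln (w j) - real k * D (of_int i / real k) - 3 * real k * \<delta> \<le> ln (w i)"
        if i: "i \<in> window k" for i
      proof -
        have dist: "\<bar>i - j\<bar> \<le> int k"
          using i j unfolding window_eq[OF elim(3)] by (auto simp: le_floor_iff ceiling_le_iff) linarith+
        \<comment> \<open>The cheaper arc to \<open>i\<close> may start at a translate of \<open>j\<close> by one period: \<open>j\<close> can be near either
          end of the window, and \<open>i\<close> can be closer to the other one.\<close>
        have "\<exists>n::int. n \<in> {-1, 0, 1} \<and> \<bar>p i - p (j + n * int k)\<bar> \<le> D (of_int i / real k) + \<delta>"
        proof -
          have "p (j - int k) = p j - T" using p_shift[of "j - int k"] by simp
          then have ex: "p (j + (-1) * int k) = p j - T" "p (j + 0 * int k) = p j"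
            "p (j + 1 * int k) = p j + T"
            using p_shift[of j] by simp_all
          have "\<bar>p i - (p j - T)\<bar> \<le> D (of_int i / real k) + \<delta> \<or> \<bar>p i - p j\<bar> \<le> D (of_int i / real k) + \<delta>
             \<or> \<bar>p i - (p j + T)\<bar> \<le> D (of_int i / real k) + \<delta>"
            using Dj Deq[OF i] Deq[OF j] by linarith
          then show ?thesis using ex by (metis insertCI)
        qed
        then obtain n :: int where n: "n \<in> {-1, 0, 1}"
          "\<bar>p i - p (j + n * int k)\<bar> \<le> D (of_int i / real k) + \<delta>" by blast
        have wn: "w (j + n * int k) = w j"
          using n(1) w_shift[of j] w_shift[of "j - int k"] by auto
        have "\<bar>i - (j + n * int k)\<bar> \<le> 2 * int k" using n(1) dist by auto
        then have "real_of_int \<bar>i - (j + n * int k)\<bar> \<le> of_int (2 * int k)"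
          by (subst of_int_le_iff)
        then have "\<delta> * of_int \<bar>i - (j + n * int k)\<bar> \<le> \<delta> * of_int (2 * int k)"
          using \<delta> by (intro mult_left_mono) auto
        moreover have "real k * \<bar>p i - p (j + n * int k)\<bar> \<le> real k * (D (of_int i / real k) + \<delta>)"
          using n(2) by (intro mult_left_mono) auto
        moreover have "\<bar>ln (w i) - ln (w (j + n * int k))\<bar> \<le>
            real k * \<bar>p i - p (j + n * int k)\<bar> + \<delta> * of_int \<bar>i - (j + n * int k)\<bar>"
          using elim(2) sol unfolding p_def by blast
        ultimately show ?thesis unfolding wn by (simp add: algebra_simps)
      qed
      have "\<bar>1 / real k * (ln (w i) - ln (w j)) + D (of_int i / real k)\<bar> \<le> \<epsilon>"
        if i: "i \<in> window k" for i
      proof -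
        have "\<bar>ln (w i) - ln (w j) + real k * D (of_int i / real k)\<bar> \<le> real k * \<epsilon>"
          using upper[OF i] lower[OF i] k assms by (simp add: \<delta>_def abs_le_iff)
        moreover have "1 / real k * (ln (w i) - ln (w j)) + D (of_int i / real k) =
            (ln (w i) - ln (w j) + real k * D (of_int i / real k)) / real k"
          using k by (simp add: field_simps)
        ultimately show ?thesis using k by (simp add: abs_divide pos_divide_le_eq mult.commute)
      qed
      then show "\<exists>j. (\<forall>i. w i \<le> w j) \<and>
        (\<forall>i \<in> window k. \<bar>1 / real k * (ln (w i) - ln (w j)) + D (of_int i / real k)\<bar> \<le> \<epsilon>)"
        using max by blast
    qed
  qed
qed

end

section \<open>Perron data and stationary probabilities\<close>

text \<open>
  Boundedness for the maximum norm over the indices below \<open>k\<close>. The operators act on all sequences,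
  and nothing is known about values at larger indices.
\<close>

definition sup_norm_bound :: "nat \<Rightarrow> real \<Rightarrow> ((nat \<Rightarrow> real) \<Rightarrow> nat \<Rightarrow> real) \<Rightarrow> bool" where
  "sup_norm_bound k C B \<longleftrightarrow>
     (\<forall>g M j. (\<forall>i<k. \<bar>g i\<bar> \<le> M) \<longrightarrow> j < k \<longrightarrow> \<bar>B g j\<bar> \<le> C * M)"

lemma funpow_bound:
  fixes B :: "(nat \<Rightarrow> real) \<Rightarrow> nat \<Rightarrow> real"
  assumes B: "sup_norm_bound k C B"
    and g: "\<And>i. i < k \<Longrightarrow> \<bar>g i\<bar> \<le> M" and "j < k"
  shows "\<bar>(B ^^ n) g j\<bar> \<le> C ^ n * M"
  using \<open>j < k\<close>
proof (induction n arbitrary: j)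
  case (Suc n)
  then have "\<bar>B ((B ^^ n) g) j\<bar> \<le> C * (C ^ n * M)" 
    using B unfolding sup_norm_bound_def by blast
  then show ?case by (simp add: mult.assoc)
qed (use g in simp)

lemma op_exp_sums:
  assumes B: "sup_norm_bound k C B"
    and "j < k"
  shows "(\<lambda>n. t ^ n / fact n * (B ^^ n) g j) sums op_exp B t g j"
proof -
  define M where "M = Max ((\<lambda>i. \<bar>g i\<bar>) ` {..<k})"
  have M: "\<bar>g i\<bar> \<le> M" if "i < k" for i unfolding M_def using that by (intro Max_ge) auto
  have "summable (\<lambda>n. t ^ n / fact n * (B ^^ n) g j)"
  proof (rule summable_comparison_test')
    show "summable (\<lambda>n. inverse (fact n) * (\<bar>t\<bar> * C) ^ n * M)"
      by (intro summable_mult2 summable_exp)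
    fix n
    have "norm (t ^ n / fact n * (B ^^ n) g j) = inverse (fact n) * \<bar>t\<bar> ^ n * \<bar>(B ^^ n) g j\<bar>"
      by (simp add: abs_mult power_abs divide_inverse)
    also have "\<dots> \<le> inverse (fact n) * \<bar>t\<bar> ^ n * (C ^ n * M)"
      by (intro mult_left_mono funpow_bound[OF B M \<open>j < k\<close>]) auto
    finally show "norm (t ^ n / fact n * (B ^^ n) g j) \<le> inverse (fact n) * (\<bar>t\<bar> * C) ^ n * M"
      by (simp add: power_mult_distrib mult.assoc)
  qed
  then show ?thesis unfolding op_exp_def by (rule summable_sums)
qed

lemma op_exp_pairing_sums:
  assumes B: "sup_norm_bound k C B"
  shows "(\<lambda>n. (\<Sum>j<k. \<rho> j * (B ^^ n) g j) / fact n * t ^ n) sums (\<Sum>j<k. \<rho> j * op_exp B t g j)"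
proof -
  have "(\<lambda>n. \<Sum>j<k. \<rho> j * (t ^ n / fact n * (B ^^ n) g j)) sums (\<Sum>j<k. \<rho> j * op_exp B t g j)"
    by (intro sums_sum sums_mult op_exp_sums[OF B]) auto
  moreover have "(\<Sum>j<k. \<rho> j * (t ^ n / fact n * (B ^^ n) g j)) =
      (\<Sum>j<k. \<rho> j * (B ^^ n) g j) / fact n * t ^ n" for n
    unfolding sum_divide_distrib sum_distrib_right by (intro sum.cong refl) simp
  ultimately show ?thesis by simp
qed

lemma left_eigenvector_op_exp:
  assumes B: "sup_norm_bound k C B"
    and eig: "\<And>g. (\<Sum>j<k. \<rho> j * B g j) = l * (\<Sum>j<k. \<rho> j * g j)"
  shows "(\<Sum>j<k. \<rho> j * op_exp B t g j) = exp (t * l) * (\<Sum>j<k. \<rho> j * g j)"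
proof -
  have pow: "(\<Sum>j<k. \<rho> j * (B ^^ n) g j) = l ^ n * (\<Sum>j<k. \<rho> j * g j)" for n
    by (induction n) (simp_all add: eig mult.assoc)
  have "(\<lambda>n. (t * l) ^ n /\<^sub>R fact n * (\<Sum>j<k. \<rho> j * g j)) sums (exp (t * l) * (\<Sum>j<k. \<rho> j * g j))"
    by (intro sums_mult2 exp_converges)
  then have "(\<lambda>n. (\<Sum>j<k. \<rho> j * (B ^^ n) g j) / fact n * t ^ n)
      sums (exp (t * l) * (\<Sum>j<k. \<rho> j * g j))"
    unfolding pow by (simp add: power_mult_distrib divide_inverse mult_ac)
  then show ?thesis using op_exp_pairing_sums[OF B, where \<rho> = \<rho>] sums_unique2 by blast
qed

text \<open>
  The pairing is a power series in \<open>t\<close> whose linear coefficient is the claimed expression, and a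
  function that is constant for \<open>t \<ge> 0\<close> has right derivative zero at \<open>0\<close>.
\<close>

lemma derivative_of_constant_pairing:
  assumes B: "sup_norm_bound k C B"
    and const: "\<And>t. 0 \<le> t \<Longrightarrow> (\<Sum>j<k. \<rho> j * op_exp B t g j) = s"
  shows "(\<Sum>j<k. \<rho> j * B g j) = 0"
proof -
  define c where "c n = (\<Sum>j<k. \<rho> j * (B ^^ n) g j) / fact n" for n
  have sums: "(\<lambda>n. c n * t ^ n) sums (\<Sum>j<k. \<rho> j * op_exp B t g j)" for t
    unfolding c_def by (rule op_exp_pairing_sums[OF B])
  let ?f = "\<lambda>t. \<Sum>n. c n * t ^ n"
  have "(?f has_field_derivative (\<Sum>n. diffs c n * 0 ^ n)) (at 0)"
    using sums by (intro termdiffs_strong_converges_everywhere) (auto simp: sums_iff)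
  then have "(?f has_field_derivative c 1) (at 0)"
    by (simp only: powser_zero) (simp add: diffs_def)
  then have "((\<lambda>h. (?f (0 + h) - ?f 0) / h) \<longlongrightarrow> c 1) (at_right 0)"
    unfolding DERIV_def by (rule tendsto_within_subset) simp
  moreover have "\<forall>\<^sub>F h in at_right 0. (?f (0 + h) - ?f 0) / h = 0"
    using eventually_at_right_less[of 0]
  proof eventually_elim
    case (elim h)
    have "?f t = s" if "0 \<le> t" for t using sums[of t] const[OF that] by (simp add: sums_iff)
    from this[of h] this[of 0] show ?case using elim by simp
  qed
  ultimately have "((\<lambda>h::real. 0::real) \<longlongrightarrow> c 1) (at_right 0)"
    by (rule Lim_transform_eventually)
  then have "c 1 = 0" by (simp add: tendsto_const_iff)
  then show ?thesis by (simp add: c_def)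
qed

lemma perturbed_gen_bound:
  assumes "k \<ge> 1"
  obtains C where "sup_norm_bound k C (\<lambda>g j. perturbed_gen V k g j - a * g j)"
proof -
  define W where "W = Max ((\<lambda>i. \<bar>V (real i / real k)\<bar>) ` {..<k})"
  have "\<bar>perturbed_gen V k g j - a * g j\<bar> \<le> (real k * 4 + real k * W + \<bar>a\<bar>) * M"
    if g: "\<forall>i<k. \<bar>g i\<bar> \<le> M" and j: "j < k" for g M j
  proof -
    have W: "\<bar>V (real j / real k)\<bar> \<le> W" unfolding W_def using j by (intro Max_ge) auto
    have "\<bar>walk_gen k g j\<bar> \<le> 4 * M"
    proof -
      have "\<bar>g ((j + 1) mod k)\<bar> \<le> M" "\<bar>g ((j + k - 1) mod k)\<bar> \<le> M" "\<bar>g j\<bar> \<le> M"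
        using g j by auto
      then show ?thesis unfolding walk_gen_def by linarith
    qed
    then have "\<bar>real k * walk_gen k g j\<bar> \<le> real k * 4 * M"
      unfolding abs_mult mult.assoc by (intro mult_mono) auto
    moreover have "\<bar>real k * V (real j / real k) * g j\<bar> \<le> real k * W * M"
      using g j W unfolding abs_mult by (intro mult_mono) auto
    moreover have "\<bar>a * g j\<bar> \<le> \<bar>a\<bar> * M" using g j unfolding abs_mult by (intro mult_left_mono) auto
    ultimately show ?thesis unfolding perturbed_gen_def by (simp add: algebra_simps)
  qed
  then show ?thesis using that unfolding sup_norm_bound_def by blast
qed

lemma perturbed_gen_symmetric:
  assumes "k \<ge> 1"
  shows "(\<Sum>j<k. f j * perturbed_gen V k g j) = (\<Sum>j<k. perturbed_gen V k f j * g j)"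
proof -
  have shift: "(\<Sum>j<k. f j * g ((j + 1) mod k)) = (\<Sum>j<k. f ((j + k - 1) mod k) * g j)"
    for f g :: "nat \<Rightarrow> real"
  proof (rule sum.reindex_bij_witness[where i = "\<lambda>j. (j + k - 1) mod k" and j = "\<lambda>j. (j + 1) mod k"])
    fix j assume j: "j \<in> {..<k}"
    have "((j + 1) mod k + k - 1) mod k = ((j + 1) mod k + (k - 1)) mod k" using assms by simp
    also have "\<dots> = (j + 1 + (k - 1)) mod k" by (rule mod_add_left_eq)
    also have "\<dots> = j" using assms j by simp
    finally show *: "((j + 1) mod k + k - 1) mod k = j" .
    show "(j + 1) mod k \<in> {..<k}" "(j + k - 1) mod k \<in> {..<k}" using assms by auto
    have "((j + k - 1) mod k + 1) mod k = (j + k - 1 + 1) mod k" by (rule mod_add_left_eq)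
    then show "((j + k - 1) mod k + 1) mod k = j" using assms j by simp
    show "f (((j + 1) mod k + k - 1) mod k) * g ((j + 1) mod k) = f j * g ((j + 1) mod k)"
      unfolding * ..
  qed
  have "(\<Sum>j<k. f j * walk_gen k g j) = (\<Sum>j<k. walk_gen k f j * g j)"
    using shift[of f g] shift[of g f]
    by (simp add: walk_gen_def algebra_simps sum.distrib sum_subtractf sum_distrib_left)
  then have "real k * (\<Sum>j<k. f j * walk_gen k g j) = real k * (\<Sum>j<k. walk_gen k f j * g j)" by simp
  then show ?thesis
    by (simp add: perturbed_gen_def algebra_simps sum.distrib sum_distrib_left)
qed

text \<open>
  Pairing \<open>\<rho>\<close> with the rescaled semigroup does not depend on \<open>t\<close>; its limit is given by the Perron
  convergence. So \<open>\<mu>\<close> spans the left eigenvectors.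
\<close>

lemma left_eigenvector_eq:
  assumes perron: "perron_data V k l u \<mu>" and "k \<ge> 1"
    and eig: "\<And>g. (\<Sum>j<k. \<rho> j * perturbed_gen V k g j) = l * (\<Sum>j<k. \<rho> j * g j)"
    and "i < k"
  shows "\<rho> i = \<mu> i * (\<Sum>j<k. \<rho> j * u j)"
proof -
  let ?A = "perturbed_gen V k"
  obtain C where "sup_norm_bound k C (\<lambda>g j. perturbed_gen V k g j - 0 * g j)"
    using perturbed_gen_bound[OF \<open>k \<ge> 1\<close>] .
  then have C: "sup_norm_bound k C ?A" by simp
  define v :: "nat \<Rightarrow> real" where "v j = (if j = i then 1 else 0)" for j
  have "((\<lambda>t. \<Sum>j<k. \<rho> j * (exp (- t * l) * op_exp ?A t v j)) \<longlongrightarrow>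
      (\<Sum>j<k. \<rho> j * ((\<Sum>i<k. v i * \<mu> i) * u j))) at_top"
    by (rule tendsto_sum, rule tendsto_mult_left) (use perron in \<open>auto simp: perron_data_def\<close>)
  moreover have "(\<Sum>j<k. \<rho> j * (exp (- t * l) * op_exp ?A t v j)) = (\<Sum>j<k. \<rho> j * v j)" for t
  proof -
    have "(\<Sum>j<k. \<rho> j * (exp (- t * l) * op_exp ?A t v j)) =
        exp (- t * l) * (\<Sum>j<k. \<rho> j * op_exp ?A t v j)"
      by (simp add: sum_distrib_left mult_ac)
    also have "\<dots> = (exp (- t * l) * exp (t * l)) * (\<Sum>j<k. \<rho> j * v j)"
      using left_eigenvector_op_exp[OF C eig, where t = t and g = v] by simp
    finally show ?thesis by (simp flip: exp_add)
  qed
  ultimately have "(\<Sum>j<k. \<rho> j * v j) = (\<Sum>j<k. \<rho> j * ((\<Sum>i<k. v i * \<mu> i) * u j))"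
    by (simp add: tendsto_const_iff)
  moreover have "(\<Sum>j<k. \<rho> j * v j) = \<rho> i" "(\<Sum>j<k. v j * \<mu> j) = \<mu> i"
    using \<open>i < k\<close> by (auto simp: v_def if_distrib[of "\<lambda>x. _ * x"] if_distrib[of "\<lambda>x. x * _"] sum.delta cong: if_cong)
  ultimately have "\<rho> i = (\<Sum>j<k. \<rho> j * (\<mu> i * u j))" by (simp only:)
  then show ?thesis by (simp add: sum_distrib_left mult_ac)
qed

text \<open>
  By symmetry of the generator \<open>u\<close> is a left eigenvector, and summing the resulting identity shows
  that its factor \<open>\<Sum>u\<^sup>2\<close> is \<open>\<Sum>u\<close>.
\<close>

lemma perron_left_eq:
  assumes perron: "perron_data V k l u \<mu>" and "k \<ge> 1" and "i < k"
  shows "u i = \<mu> i * (\<Sum>j<k. u j)" "(\<Sum>j<k. u j * u j) = (\<Sum>j<k. u j)"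
proof -
  have "(\<Sum>j<k. u j * perturbed_gen V k g j) = l * (\<Sum>j<k. u j * g j)" for g
    using perron by (simp add: perturbed_gen_symmetric[OF \<open>k \<ge> 1\<close>] perron_data_def sum_distrib_left mult_ac)
  then have *: "u i = \<mu> i * (\<Sum>j<k. u j * u j)" if "i < k" for i
    by (intro left_eigenvector_eq[OF perron \<open>k \<ge> 1\<close> _ that])
  have "(\<Sum>i<k. u i) = (\<Sum>i<k. \<mu> i * (\<Sum>j<k. u j * u j))" by (intro sum.cong * refl) auto
  also have "\<dots> = (\<Sum>j<k. u j * u j)"
    using perron by (simp add: perron_data_def prob_vector_def flip: sum_distrib_right)
  finally show "(\<Sum>j<k. u j * u j) = (\<Sum>j<k. u j)" by simp
  then show "u i = \<mu> i * (\<Sum>j<k. u j)" using *[OF \<open>i < k\<close>] by simp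
qed

text \<open>
  Stationarity under the conjugated semigroup means that \<open>p / u\<close> annihilates the range of the
  generator minus \<open>l\<close>, so \<open>p / u\<close> is a left eigenvector. Its factor is the total mass of \<open>p\<close>.
\<close>

lemma stationary_prob_eq:
  assumes perron: "perron_data V k l u \<mu>" and "k \<ge> 1" and "i < k"
    and stat: "stationary_prob k (gibbs_semigroup V k l u) p"
  shows "p i = u i * \<mu> i"
proof -
  define \<rho> where "\<rho> j = p j / u j" for j
  have u: "0 < u j" if "j < k" for j using perron that by (simp add: perron_data_def)
  let ?B = "\<lambda>g i. perturbed_gen V k g i - l * g i"
  obtain C where C: "sup_norm_bound k C ?B"
    using perturbed_gen_bound[OF \<open>k \<ge> 1\<close>] .
  have "(\<Sum>j<k. \<rho> j * perturbed_gen V k g j) = l * (\<Sum>j<k. \<rho> j * g j)" for g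
  proof -
    define f where "f i = g i / u i" for i
    have "(\<Sum>j<k. \<rho> j * ?B (\<lambda>i. u i * f i) j) = 0"
    proof (rule derivative_of_constant_pairing[OF C])
      fix t :: real assume "0 \<le> t"
      then have "(\<Sum>j<k. p j * gibbs_semigroup V k l u t f j) = (\<Sum>j<k. p j * f j)"
        using stat by (simp add: stationary_prob_def)
      then show "(\<Sum>j<k. \<rho> j * op_exp ?B t (\<lambda>i. u i * f i) j) = (\<Sum>j<k. p j * f j)"
        by (simp add: gibbs_semigroup_def \<rho>_def)
    qed
    moreover have "?B (\<lambda>i. u i * f i) j = ?B g j" if "j < k" for j
    proof -
      have "u i * f i = g i" if "i < k" for i using u[OF that] by (simp add: f_def)
      then show ?thesis using that \<open>k \<ge> 1\<close> by (simp add: perturbed_gen_def walk_gen_def)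
    qed
    ultimately have "(\<Sum>j<k. \<rho> j * ?B g j) = 0" by simp
    then show ?thesis by (simp add: right_diff_distrib sum_subtractf sum_distrib_left mult_ac)
  qed
  then have "\<rho> i = \<mu> i * (\<Sum>j<k. \<rho> j * u j)"
    by (rule left_eigenvector_eq[OF perron \<open>k \<ge> 1\<close> _ \<open>i < k\<close>])
  also have "(\<Sum>j<k. \<rho> j * u j) = (\<Sum>j<k. p j)"
    by (intro sum.cong refl) (use u in \<open>force simp: \<rho>_def\<close>)
  also have "\<dots> = 1" using stat by (simp add: stationary_prob_def prob_vector_def)
  finally show ?thesis using u[OF \<open>i < k\<close>] by (simp add: \<rho>_def field_simps)
qed

section \<open>Exponential asymptotics of functions on the lattice\<close>

text \<open>
  \<open>\<phi> k j = exp (- k (f (j / k) + o(1)))\<close>, uniformly in \<open>j\<close>.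
\<close>

definition log_asymptotic :: "(nat \<Rightarrow> nat \<Rightarrow> real) \<Rightarrow> (real \<Rightarrow> real) \<Rightarrow> bool" where
  "log_asymptotic \<phi> f \<longleftrightarrow>
     (\<forall>\<epsilon>>0. \<forall>\<^sub>F k in sequentially. \<forall>j<k.
        0 < \<phi> k j \<and> \<bar>1 / real k * ln (\<phi> k j) + f (real j / real k)\<bar> \<le> \<epsilon>)"

lemma log_asymptotic_mult:
  assumes "log_asymptotic \<phi> f" "log_asymptotic \<psi> g"
  shows "log_asymptotic (\<lambda>k j. \<phi> k j * \<psi> k j) (\<lambda>x. f x + g x)"
  unfolding log_asymptotic_def
proof (intro allI impI)
  fix \<epsilon> :: real assume "\<epsilon> > 0"
  then have e: "\<epsilon> / 2 > 0" by simp
  from assms(1)[unfolded log_asymptotic_def, rule_format, OF e]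
    assms(2)[unfolded log_asymptotic_def, rule_format, OF e]
  show "\<forall>\<^sub>F k in sequentially. \<forall>j<k. 0 < \<phi> k j * \<psi> k j \<and>
      \<bar>1 / real k * ln (\<phi> k j * \<psi> k j) + (f (real j / real k) + g (real j / real k))\<bar> \<le> \<epsilon>"
  proof eventually_elim
    case (elim k)
    show ?case
    proof (intro allI impI conjI)
      fix j assume "j < k"
      then have *: "0 < \<phi> k j" "0 < \<psi> k j"
        "\<bar>1 / real k * ln (\<phi> k j) + f (real j / real k)\<bar> \<le> \<epsilon> / 2"
        "\<bar>1 / real k * ln (\<psi> k j) + g (real j / real k)\<bar> \<le> \<epsilon> / 2"
        using elim by auto
      then show "0 < \<phi> k j * \<psi> k j" by simp
      have "1 / real k * ln (\<phi> k j * \<psi> k j) = 1 / real k * ln (\<phi> k j) + 1 / real k * ln (\<psi> k j)"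
        using * by (simp add: ln_mult_pos add_divide_distrib)
      then show "\<bar>1 / real k * ln (\<phi> k j * \<psi> k j) + (f (real j / real k) + g (real j / real k))\<bar> \<le> \<epsilon>"
        using *(3,4) by linarith
    qed
  qed
qed

lemma log_asymptotic_mult_subexponential:
  assumes "log_asymptotic \<phi> f" "\<And>k. k \<ge> 1 \<Longrightarrow> 0 < c k" "(\<lambda>k. 1 / real k * ln (c k)) \<longlonglongrightarrow> 0"
  shows "log_asymptotic (\<lambda>k j. \<phi> k j * c k) f"
proof -
  have "log_asymptotic (\<lambda>k j. c k) (\<lambda>x. 0)"
    unfolding log_asymptotic_def
  proof (intro allI impI)
    fix \<epsilon> :: real assume "\<epsilon> > 0"
    then have "\<forall>\<^sub>F k in sequentially. dist (1 / real k * ln (c k)) 0 < \<epsilon>"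
      using assms(3) tendstoD by blast
    then show "\<forall>\<^sub>F k in sequentially. \<forall>j<k. 0 < c k \<and> \<bar>1 / real k * ln (c k) + 0\<bar> \<le> \<epsilon>"
      using eventually_ge_at_top[of 1]
      by eventually_elim (use assms(2) in \<open>auto simp: dist_real_def\<close>)
  qed
  from log_asymptotic_mult[OF assms(1) this] show ?thesis by simp
qed

lemma log_asymptotic_cong:
  assumes "log_asymptotic \<phi> f" "\<And>k j. j < k \<Longrightarrow> \<psi> k j = \<phi> k j"
  shows "log_asymptotic \<psi> f"
  using assms by (simp add: log_asymptotic_def)

text \<open>
  The interpolation is a convex combination of the values at two neighbouring lattice points,
  so no logarithm of an interpolated value needs to be computed.
\<close>

lemma cont_ext_between:
  assumes "k \<ge> 1" and x: "x \<in> {0..<1}"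
  obtains j where "j < k" "real j / real k \<le> x" "x < real (j + 1) / real k"
    "min (\<phi> j) (\<phi> ((j + 1) mod k)) \<le> cont_ext k \<phi> x"
    "cont_ext k \<phi> x \<le> max (\<phi> j) (\<phi> ((j + 1) mod k))"
proof -
  have k: "real k > 0" using assms(1) by simp
  have fr: "frac x = x" using x by (simp add: frac_eq)
  define j where "j = nat \<lfloor>real k * x\<rfloor>"
  have nonneg: "0 \<le> real k * x" using x k by simp
  have fl: "real j = of_int \<lfloor>real k * x\<rfloor>" using nonneg by (simp add: j_def)
  have j1: "real j \<le> real k * x" "real k * x < real j + 1" unfolding fl by linarith+
  have "real k * x < real k" using x k by simp
  then have jk: "j < k" using j1(1) by linarith
  have lo: "real j / real k \<le> x" using j1(1) k by (simp add: pos_divide_le_eq mult.commute)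
  have hi: "x < real (j + 1) / real k" using j1(2) k by (simp add: pos_less_divide_eq mult.commute)
  define a where "a = (real j + 1) / real k - 1 / (real k)\<^sup>2"
  have eq: "cont_ext k \<phi> x = (if x \<le> a then \<phi> j
         else \<phi> j + (\<phi> ((j + 1) mod k) - \<phi> j) * ((x - a) * (real k)\<^sup>2))"
    unfolding cont_ext_def fr j_def[symmetric] Let_def a_def ..
  have "min (\<phi> j) (\<phi> ((j + 1) mod k)) \<le> cont_ext k \<phi> x \<and>
    cont_ext k \<phi> x \<le> max (\<phi> j) (\<phi> ((j + 1) mod k))"
  proof (cases "x \<le> a")
    case False
    define t where "t = (x - a) * (real k)\<^sup>2"
    have t0: "0 \<le> t" using False by (simp add: t_def)
    have "x - a \<le> 1 / (real k)\<^sup>2" using hi by (simp add: a_def add.commute)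
    then have "t \<le> 1 / (real k)\<^sup>2 * (real k)\<^sup>2" unfolding t_def by (intro mult_right_mono) auto
    then have t1: "t \<le> 1" using k by simp
    have c: "cont_ext k \<phi> x = (1 - t) * \<phi> j + t * \<phi> ((j + 1) mod k)"
      using False unfolding eq t_def[symmetric] by (simp add: algebra_simps)
    show ?thesis unfolding c
      using t0 t1 convex_bound_le[of "\<phi> j" "max (\<phi> j) (\<phi> ((j + 1) mod k))" "\<phi> ((j + 1) mod k)" "1 - t" t]
        convex_bound_le[of "- \<phi> j" "- min (\<phi> j) (\<phi> ((j + 1) mod k))" "- \<phi> ((j + 1) mod k)" "1 - t" t]
      by auto
  qed (simp add: eq)
  then show ?thesis using that jk lo hi by blast
qed

lemma uniform_limit_log_cont_ext:
  assumes cont: "continuous_on UNIV f" and per: "\<And>x. f (x + 1) = f x"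
    and asym: "log_asymptotic \<phi> f"
  shows "uniform_limit {0..<1} (\<lambda>k x. 1 / real k * ln (cont_ext k (\<phi> k) x)) (\<lambda>x. - f x) sequentially"
proof (rule uniform_limitI)
  fix \<epsilon> :: real assume "\<epsilon> > 0"
  then have e: "\<epsilon> / 3 > 0" by simp
  obtain d where d: "d > 0" "\<And>x y. \<bar>x - y\<bar> < d \<Longrightarrow> \<bar>f x - f y\<bar> < \<epsilon> / 3"
    using periodic_uniformly_continuous[OF cont per e] by blast
  have "\<forall>\<^sub>F k in sequentially. 1 / real k < d"
    using order_tendstoD(2)[OF lim_1_over_n d(1)] .
  with asym[unfolded log_asymptotic_def, rule_format, OF e] eventually_ge_at_top[of 1]
  show "\<forall>\<^sub>F k in sequentially. \<forall>x\<in>{0..<1}.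
      dist (1 / real k * ln (cont_ext k (\<phi> k) x)) (- f x) < \<epsilon>"
  proof eventually_elim
    case (elim k)
    have k: "real k > 0" using elim by simp
    show ?case
    proof
      fix x :: real assume x: "x \<in> {0..<1}"
      obtain j where j: "j < k" "real j / real k \<le> x" "x < real (j + 1) / real k"
        and b: "min (\<phi> k j) (\<phi> k ((j + 1) mod k)) \<le> cont_ext k (\<phi> k) x"
          "cont_ext k (\<phi> k) x \<le> max (\<phi> k j) (\<phi> k ((j + 1) mod k))"
        using cont_ext_between[OF elim(2) x] by metis
      have j': "(j + 1) mod k < k" using elim(2) by simp
      have width: "real (j + 1) / real k = real j / real k + 1 / real k"
        by (simp add: add_divide_distrib)
      have f1: "\<bar>f (real j / real k) - f x\<bar> < \<epsilon> / 3"
        using j(2,3) width elim(3) by (intro d(2)) linarith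
      have "\<bar>f (real (j + 1) / real k) - f x\<bar> < \<epsilon> / 3"
        using j(2,3) width elim(3) by (intro d(2)) linarith
      moreover have "f (real ((j + 1) mod k) / real k) = f (real (j + 1) / real k)"
      proof (cases "j + 1 = k")
        case True
        then show ?thesis using k per[of 0] by simp
      qed (use j(1) in simp)
      ultimately have f2: "\<bar>f (real ((j + 1) mod k) / real k) - f x\<bar> < \<epsilon> / 3" by simp
      let ?L = "\<lambda>y. 1 / real k * ln y"
      have p: "0 < \<phi> k j" "0 < \<phi> k ((j + 1) mod k)"
        and l: "\<bar>?L (\<phi> k j) + f (real j / real k)\<bar> \<le> \<epsilon> / 3"
          "\<bar>?L (\<phi> k ((j + 1) mod k)) + f (real ((j + 1) mod k) / real k)\<bar> \<le> \<epsilon> / 3"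
        using elim(1) j(1) j' by auto
      have mono: "?L y \<le> ?L z" if "0 < y" "y \<le> z" for y z
        using that k by (intro mult_left_mono) auto
      have min_pos: "0 < min (\<phi> k j) (\<phi> k ((j + 1) mod k))" using p by simp
      then have ext_pos: "0 < cont_ext k (\<phi> k) x" using b(1) by linarith
      have lm: "?L (min (\<phi> k j) (\<phi> k ((j + 1) mod k))) \<le> ?L (cont_ext k (\<phi> k) x)"
        "?L (cont_ext k (\<phi> k) x) \<le> ?L (max (\<phi> k j) (\<phi> k ((j + 1) mod k)))"
        by (rule mono[OF min_pos b(1)] mono[OF ext_pos b(2)])+
      have "\<bar>?L (cont_ext k (\<phi> k) x) + f x\<bar> < \<epsilon>"
      proof (cases "\<phi> k j \<le> \<phi> k ((j + 1) mod k)")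
        case True
        then show ?thesis
          using lm l f1 f2 unfolding min_absorb1[OF True] max_absorb2[OF True] by linarith
      next
        case False
        then have le: "\<phi> k ((j + 1) mod k) \<le> \<phi> k j" by simp
        show ?thesis
          using lm l f1 f2 unfolding min_absorb2[OF le] max_absorb1[OF le] by linarith
      qed
      then show "dist (1 / real k * ln (cont_ext k (\<phi> k) x)) (- f x) < \<epsilon>"
        by (simp add: dist_real_def)
    qed
  qed
qed

lemma frac_lattice:
  assumes "k \<ge> 1"
  shows "frac (of_int i / real k) = real (nat (i mod int k)) / real k"
proof -
  have k: "real k > 0" using assms by simp
  have m: "0 \<le> i mod int k" "i mod int k < int k" using assms by auto
  have r: "real (nat (i mod int k)) = of_int (i mod int k)" using m(1) by simp
  have "of_int i = of_int (i div int k * int k + i mod int k)" by simp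
  then have "(of_int i :: real) = of_int (i div int k) * real k + of_int (i mod int k)"
    by (metis of_int_add of_int_mult of_int_of_nat_eq)
  then have "of_int i / real k - of_int (i mod int k) / real k = of_int (i div int k)"
    using k by (simp add: field_simps)
  then have "of_int i / real k - of_int (i mod int k) / real k \<in> \<int>" by simp
  moreover have "of_int (i mod int k) < real k" using m(2) by linarith
  ultimately show ?thesis unfolding r frac_unique_iff using m(1) k by simp
qed

text \<open>
  Laplace's principle. From above, the measure of the arc is at most \<open>k\<close> times its largest point
  mass. From below, one lattice point with \<open>f\<close> close to its infimum suffices; it exists for large
  \<open>k\<close> because the infimum is nearly attained in the interior of the arc, which is nonempty as
  \<open>c < d\<close>.
\<close>

lemma large_deviation_principle:
  assumes cont: "continuous_on UNIV f" and per: "\<And>x. f (x + 1) = f x" and nonneg: "\<And>x. 0 \<le> f x"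
    and asym: "log_asymptotic p f" and "c < d"
  shows "(\<lambda>k. 1 / real k * ln (lattice_measure k (p k) (arc_set c d)))
          \<longlonglongrightarrow> - (INF x\<in>arc_set c d. f x)"
proof (rule tendstoI)
  let ?F = "arc_set c d"
  define I where "I = (INF x\<in>?F. f x)"
  note per_frac = periodic_frac[of f, OF per]
  have bdd: "bdd_below (f ` ?F)" using nonneg by (intro bdd_belowI[of _ 0]) auto
  have Ile: "I \<le> f x" if "x \<in> ?F" for x unfolding I_def using bdd that by (rule cINF_lower)
  fix \<epsilon>' :: real assume "\<epsilon>' > 0"
  define \<epsilon> where "\<epsilon> = \<epsilon>' / 4"
  have e: "\<epsilon> > 0" using \<open>\<epsilon>' > 0\<close> by (simp add: \<epsilon>_def)
  have "?F \<noteq> {}" using \<open>c < d\<close> by (simp add: arc_set_def)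
  then have "\<exists>z\<in>?F. f z < I + \<epsilon>"
    using cINF_less_iff[OF _ bdd, of "I + \<epsilon>"] e by (simp add: I_def)
  then obtain y where y: "y \<in> {c..d}" "f y < I + \<epsilon>"
    by (auto simp: arc_set_def per_frac)
  have "open {x. f x < I + \<epsilon>}"
    using cont by (intro open_Collect_less) auto
  moreover have "closure {c<..<d} = {c..d}" using \<open>c < d\<close> by simp
  ultimately have "{x. f x < I + \<epsilon>} \<inter> {c<..<d} \<noteq> {}"
    using y open_Int_closure_eq_empty by blast
  then obtain z where z: "c < z" "z < d" "f z < I + \<epsilon>" by auto
  obtain \<delta> where \<delta>: "\<delta> > 0" "\<And>x y. \<bar>x - y\<bar> < \<delta> \<Longrightarrow> \<bar>f x - f y\<bar> < \<epsilon>"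
    using periodic_uniformly_continuous[OF cont per e] by blast
  have "min \<delta> (z - c) > 0" using \<delta>(1) z(1) by simp
  then have "\<forall>\<^sub>F k in sequentially. 1 / real k < min \<delta> (z - c)"
    using order_tendstoD(2)[OF lim_1_over_n] by blast
  moreover have "\<forall>\<^sub>F k in sequentially. ln (real k) / real k < \<epsilon>"
    using order_tendstoD(2)[OF lim_ln_over_n e] .
  moreover note asym[unfolded log_asymptotic_def, rule_format, OF e] eventually_ge_at_top[of 1]
  ultimately show "\<forall>\<^sub>F k in sequentially.
      dist (1 / real k * ln (lattice_measure k (p k) ?F)) (- (INF x\<in>?F. f x)) < \<epsilon>'"
    unfolding I_def[symmetric]
  proof eventually_elim
    case (elim k)
    let ?S = "{j. j < k \<and> real j / real k \<in> ?F}"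
    let ?m = "lattice_measure k (p k) ?F"
    have k: "real k > 0" using elim(4) by simp
    have fin: "finite ?S" by simp
    have logk: "1 / real k * x \<le> y \<longleftrightarrow> x \<le> real k * y" "y \<le> 1 / real k * x \<longleftrightarrow> real k * y \<le> x" for x y
      using k by (simp_all add: pos_divide_le_eq pos_le_divide_eq mult.commute)
    have pj: "0 < p k j" "real k * (- f (real j / real k) - \<epsilon>) \<le> ln (p k j)"
      "ln (p k j) \<le> real k * (- f (real j / real k) + \<epsilon>)" if "j \<in> ?S" for j
    proof -
      have *: "0 < p k j" "\<bar>1 / real k * ln (p k j) + f (real j / real k)\<bar> \<le> \<epsilon>"
        using elim(3) that by auto
      then show "0 < p k j" by simp
      show "real k * (- f (real j / real k) - \<epsilon>) \<le> ln (p k j)"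
        unfolding logk(2)[symmetric] using *(2) by linarith
      show "ln (p k j) \<le> real k * (- f (real j / real k) + \<epsilon>)"
        unfolding logk(1)[symmetric] using *(2) by linarith
    qed
    define i where "i = \<lfloor>real k * z\<rfloor>"
    have "of_int i \<le> real k * z" "real k * z < of_int i + 1" unfolding i_def by linarith+
    then have i: "of_int i / real k \<le> z" "z < of_int i / real k + 1 / real k"
      using k by (auto simp: field_simps)
    define j where "j = nat (i mod int k)"
    have fr: "frac (of_int i / real k) = real j / real k"
      unfolding j_def by (rule frac_lattice[OF elim(4)])
    have "of_int i / real k \<in> {c..d}" using i elim(1) z by auto
    then have "real j / real k \<in> ?F" unfolding arc_set_def fr[symmetric] by (rule imageI)
    then have j: "j \<in> ?S" using elim(4) by (simp add: j_def nat_less_iff)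
    have "f (real j / real k) = f (of_int i / real k)" unfolding fr[symmetric] by (rule per_frac)
    moreover have "\<bar>f (of_int i / real k) - f z\<bar> < \<epsilon>" using i elim(1) by (intro \<delta>(2)) auto
    ultimately have fj: "f (real j / real k) < I + 2 * \<epsilon>" using z(3) by linarith
    have pm: "p k j \<le> ?m"
      unfolding lattice_measure_def using fin j pj(1) by (intro member_le_sum) (auto intro: less_imp_le)
    then have mpos: "0 < ?m" using pj(1)[OF j] by linarith
    have "ln (p k j) \<le> ln ?m" using pm pj(1)[OF j] mpos by simp
    then have "real k * (- f (real j / real k) - \<epsilon>) \<le> ln ?m" using pj(2)[OF j] by linarith
    then have lower: "- f (real j / real k) - \<epsilon> \<le> 1 / real k * ln ?m" unfolding logk(2) .
    have "?m \<le> (\<Sum>j\<in>?S. exp (real k * (\<epsilon> - I)))"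
      unfolding lattice_measure_def
    proof (rule sum_mono)
      fix j assume j: "j \<in> ?S"
      have "ln (p k j) \<le> real k * (- f (real j / real k) + \<epsilon>)" using pj(3)[OF j] .
      also have "\<dots> \<le> real k * (\<epsilon> - I)" using Ile j k by (intro mult_left_mono) auto
      finally have "exp (ln (p k j)) \<le> exp (real k * (\<epsilon> - I))" by simp
      then show "p k j \<le> exp (real k * (\<epsilon> - I))" using pj(1)[OF j] by simp
    qed
    also have "\<dots> = real (card ?S) * exp (real k * (\<epsilon> - I))" by simp
    also have "\<dots> \<le> real k * exp (real k * (\<epsilon> - I))"
    proof -
      have "card ?S \<le> card {..<k}" by (intro card_mono) auto
      then show ?thesis by simp
    qed
    finally have "ln ?m \<le> ln (real k * exp (real k * (\<epsilon> - I)))" using mpos k by simp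
    also have "\<dots> = ln (real k) + real k * (\<epsilon> - I)" using k by (simp add: ln_mult_pos)
    finally have "1 / real k * ln ?m \<le> 1 / real k * (ln (real k) + real k * (\<epsilon> - I))"
      using k by (intro mult_left_mono) auto
    also have "\<dots> = ln (real k) / real k + (\<epsilon> - I)" using k by (simp add: field_simps)
    finally have upper: "1 / real k * ln ?m \<le> ln (real k) / real k + (\<epsilon> - I)" .
    show ?case
      using upper lower fj elim(2) e unfolding dist_real_def \<epsilon>_def by linarith
  qed
qed

section \<open>Asymptotics of the Perron data\<close>

lemma perron_periodic_solution:
  assumes perron: "perron_data V k l u \<mu>" and k: "k \<ge> 1" and per: "\<And>x. V (x + 1) = V x"
  shows "periodic_solution V k (l / real k) (\<lambda>i. u (nat (i mod int k)))"
  unfolding periodic_solution_def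
proof (intro conjI allI)
  fix i :: int
  define j where "j = nat (i mod int k)"
  have j: "j < k" "int j = i mod int k" using k by (auto simp: j_def nat_less_iff)
  show "0 < u (nat (i mod int k))" using perron j(1) by (simp add: perron_data_def j_def)
  show "u (nat ((i + int k) mod int k)) = u (nat (i mod int k))" by simp
  have "int ((j + 1) mod k) = (i + 1) mod int k"
    by (simp add: zmod_int j(2) mod_add_right_eq add.commute)
  then have plus: "nat ((i + 1) mod int k) = (j + 1) mod k" by linarith
  have "int ((j + k - 1) mod k) = (i mod int k + int k - 1) mod int k"
    using k by (simp add: zmod_int j(2) of_nat_diff)
  also have "\<dots> = (i mod int k + (int k - 1)) mod int k" by (simp only: add_diff_eq)
  also have "\<dots> = (i + (int k - 1)) mod int k" by (rule mod_add_left_eq)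
  also have "\<dots> = (i - 1) mod int k" by (metis add.commute diff_add_eq mod_add_self2 add_diff_eq)
  finally have minus: "nat ((i - 1) mod int k) = (j + k - 1) mod k" by linarith
  have "V (of_int i / real k) = V (frac (of_int i / real k))"
    using periodic_frac[of V] per by simp
  then have V: "V (of_int i / real k) = V (real j / real k)"
    using frac_lattice[OF k] by (simp add: j_def)
  have "perturbed_gen V k u j = l * u j" using perron j(1) by (simp add: perron_data_def)
  then have "real k * (u ((j + 1) mod k) + u ((j + k - 1) mod k) - 2 * u j + V (real j / real k) * u j) = l * u j"
    by (simp add: perturbed_gen_def walk_gen_def algebra_simps)
  then have "u ((j + 1) mod k) + u ((j + k - 1) mod k) - 2 * u j + V (real j / real k) * u j = l / real k * u j"
    using k by (simp add: field_simps)
  then show "u (nat ((i + 1) mod int k)) + u (nat ((i - 1) mod int k)) =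
      (2 + l / real k - V (of_int i / real k)) * u (nat (i mod int k))"
    unfolding plus minus V j_def[symmetric] by (simp add: algebra_simps)
qed

text \<open>
  As \<open>\<Sum>u \<mu> = 1\<close> is a mean of \<open>u\<close>, the maximum is at least 1. From \<open>\<Sum>u\<^sup>2 = \<Sum>u\<close> the square of the maximum
  is at most \<open>k\<close> times the maximum.
\<close>

lemma perron_normalization:
  assumes perron: "perron_data V k l u \<mu>" and "k \<ge> 1"
    and j: "j < k" and max: "\<And>i. i < k \<Longrightarrow> u i \<le> u j"
  shows "1 \<le> u j" "u j \<le> real k" "1 \<le> (\<Sum>i<k. u i)" "(\<Sum>i<k. u i) \<le> (real k)\<^sup>2"
proof -
  have pos: "0 < u i" if "i < k" for i using perron that by (simp add: perron_data_def)
  have "1 = (\<Sum>i<k. u i * \<mu> i)" using perron by (simp add: perron_data_def)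
  also have "\<dots> \<le> (\<Sum>i<k. u j * \<mu> i)"
    using perron max by (intro sum_mono mult_right_mono) (auto simp: perron_data_def prob_vector_def)
  also have "\<dots> = u j"
    using perron by (simp add: perron_data_def prob_vector_def flip: sum_distrib_left)
  finally show one: "1 \<le> u j" .
  have sum: "(\<Sum>i<k. u i) \<le> real k * u j"
    using sum_bounded_above[of "{..<k}" u "u j"] max by simp
  have "u j * u j \<le> (\<Sum>i<k. u i * u i)"
    using j pos by (intro member_le_sum[where f = "\<lambda>i. u i * u i"]) (auto intro: less_imp_le)
  also have "\<dots> \<le> real k * u j" using perron_left_eq(2)[OF perron \<open>k \<ge> 1\<close> j] sum by simp
  finally show le: "u j \<le> real k" using pos[OF j] by simp
  have "u j \<le> (\<Sum>i<k. u i)"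
    using j pos by (intro member_le_sum) (auto intro: less_imp_le)
  then show "1 \<le> (\<Sum>i<k. u i)" using one by linarith
  have "real k * u j \<le> real k * real k" using le by (intro mult_left_mono) auto
  then show "(\<Sum>i<k. u i) \<le> (real k)\<^sup>2" using sum by (simp add: power2_eq_square)
qed

lemma subexponential:
  assumes "\<And>k. k \<ge> 1 \<Longrightarrow> 1 \<le> c k" "\<And>k. k \<ge> 1 \<Longrightarrow> c k \<le> (real k)\<^sup>2"
  shows "(\<lambda>k. 1 / real k * ln (c k)) \<longlonglongrightarrow> 0"
proof (rule tendsto_sandwich[where f = "\<lambda>_. 0" and h = "\<lambda>k. 2 * (ln (real k) / real k)"])
  show "(\<lambda>k. 2 * (ln (real k) / real k)) \<longlonglongrightarrow> 0"
    using tendsto_mult_left[OF lim_ln_over_n, of 2] by simp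
  show "\<forall>\<^sub>F k in sequentially. 0 \<le> 1 / real k * ln (c k)"
    using eventually_ge_at_top[of 1] by eventually_elim (use assms(1) in simp)
  show "\<forall>\<^sub>F k in sequentially. 1 / real k * ln (c k) \<le> 2 * (ln (real k) / real k)"
    using eventually_ge_at_top[of 1]
  proof eventually_elim
    case (elim k)
    have "ln (c k) \<le> ln ((real k)\<^sup>2)"
      using assms[OF elim] elim by (subst ln_le_cancel_iff) (auto intro: less_le_trans)
    also have "\<dots> = 2 * ln (real k)" using elim by (simp add: ln_realpow)
    finally show ?case using elim by (simp add: divide_right_mono)
  qed
qed simp

text \<open>
  \<open>solution_asymptotics\<close> describes \<open>u\<close> relative to its maximum, which is subexponential.
\<close>

lemma (in circle_potential) eigenfunction_asymptotics:
  assumes perron: "\<And>k. k \<ge> 1 \<Longrightarrow> perron_data V k (l k) (uk k) (\<mu>k k)"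
  shows "log_asymptotic uk D"
proof -
  let ?w = "\<lambda>k i. uk k (nat (i mod int k))"
  define U where "U k = (if k = 0 then 1 else Max (uk k ` {..<k}))" for k
  have U: "\<exists>j<k. U k = uk k j" "\<And>i. i < k \<Longrightarrow> uk k i \<le> U k" if "k \<ge> 1" for k
  proof -
    have "Max (uk k ` {..<k}) \<in> uk k ` {..<k}" using that by (intro Max_in) (auto simp: lessThan_empty_iff)
    then show "\<exists>j<k. U k = uk k j" using that by (auto simp: U_def)
    show "\<And>i. i < k \<Longrightarrow> uk k i \<le> U k" unfolding U_def by simp
  qed
  have Ub: "1 \<le> U k" "U k \<le> real k" if k: "k \<ge> 1" for k
  proof -
    obtain j where j: "j < k" "U k = uk k j" using U(1)[OF k] by blast
    then show "1 \<le> U k" "U k \<le> real k"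
      using perron_normalization(1,2)[OF perron[OF k] k j(1)] U(2)[OF k] by auto
  qed
  have "U k \<le> (real k)\<^sup>2" if k: "k \<ge> 1" for k
  proof -
    have "real k * 1 \<le> real k * real k" using k by (intro mult_left_mono) auto
    then show ?thesis using Ub(2)[OF k] by (simp add: power2_eq_square)
  qed
  then have lim: "(\<lambda>k. 1 / real k * ln (U k)) \<longlonglongrightarrow> 0" using Ub(1) by (rule subexponential[rotated])
  have "log_asymptotic (\<lambda>k j. uk k j / U k) D"
    unfolding log_asymptotic_def
  proof (intro allI impI)
    fix \<epsilon> :: real assume "\<epsilon> > 0"
    from solution_asymptotics[OF this] eventually_ge_at_top[of 1]
    show "\<forall>\<^sub>F k in sequentially. \<forall>j<k. 0 < uk k j / U k \<and>
        \<bar>1 / real k * ln (uk k j / U k) + D (real j / real k)\<bar> \<le> \<epsilon>"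
    proof eventually_elim
      case (elim k)
      have sol: "periodic_solution V k (l k / real k) (?w k)"
        by (rule perron_periodic_solution[OF perron[OF elim(2)] elim(2) V_periodic])
      obtain j0 where max: "\<And>i. ?w k i \<le> ?w k j0" and asym: "\<And>i. i \<in> window k \<Longrightarrow>
          \<bar>1 / real k * (ln (?w k i) - ln (?w k j0)) + D (of_int i / real k)\<bar> \<le> \<epsilon>"
        using elim(1)[rule_format, OF sol] by blast
      have nat: "?w k (int j) = uk k j" if "j < k" for j using that by simp
      have "?w k j0 = U k"
      proof (rule antisym)
        show "?w k j0 \<le> U k" using elim(2) by (intro U(2)) (auto simp: nat_less_iff)
        obtain j where "j < k" "U k = uk k j" using U(1)[OF elim(2)] by blast
        then show "U k \<le> ?w k j0" using max[of "int j"] by simp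
      qed
      note asym = asym[unfolded this]
      show ?case
      proof (intro allI impI)
        fix j assume j: "j < k"
        \<comment> \<open>the representative of \<open>j\<close> modulo \<open>k\<close> in the window \<open>[m, m + 1]\<close>\<close>
        define a where "a = \<lceil>m * real k\<rceil>"
        define i where "i = a + (int j - a) mod int k"
        have "i \<in> window k"
          using elim(2) by (intro window_cover) (auto simp: i_def a_def)
        moreover have "i mod int k = int j mod int k"
          unfolding i_def by (simp add: mod_add_right_eq)
        then have imod: "nat (i mod int k) = j" using j by simp
        moreover have "D (of_int i / real k) = D (real j / real k)"
          using periodic_frac[of D "of_int i / real k"] D_periodic
            frac_lattice[OF elim(2), of i] imod by simp
        ultimately have "\<bar>1 / real k * (ln (uk k j) - ln (U k)) + D (real j / real k)\<bar> \<le> \<epsilon>"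
          using asym[of i] by simp
        moreover have "0 < uk k j" "0 < U k"
          using perron[OF elim(2)] j Ub(1)[OF elim(2)] by (auto simp: perron_data_def)
        ultimately show "0 < uk k j / U k \<and>
            \<bar>1 / real k * ln (uk k j / U k) + D (real j / real k)\<bar> \<le> \<epsilon>"
          by (simp add: ln_div)
      qed
    qed
  qed
  then have "log_asymptotic (\<lambda>k j. uk k j / U k * U k) D"
    using Ub(1) lim by (intro log_asymptotic_mult_subexponential) force+
  then show ?thesis
  proof (rule log_asymptotic_cong)
    fix k j :: nat assume "j < k"
    then have "U k \<noteq> 0" using Ub(1)[of k] by force
    then show "uk k j = uk k j / U k * U k" by simp
  qed
qed

lemma (in circle_potential) eigenprobability_asymptotics:
  assumes perron: "\<And>k. k \<ge> 1 \<Longrightarrow> perron_data V k (l k) (uk k) (\<mu>k k)"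
  shows "log_asymptotic \<mu>k D"
proof -
  define S where "S k = (if k = 0 then 1 else \<Sum>i<k. uk k i)" for k
  have S: "1 \<le> S k" "S k \<le> (real k)\<^sup>2" if k: "k \<ge> 1" for k
  proof -
    have "Max (uk k ` {..<k}) \<in> uk k ` {..<k}" using k by (intro Max_in) (auto simp: lessThan_empty_iff)
    then obtain j where j: "j < k" "uk k j = Max (uk k ` {..<k})" by auto
    have "uk k i \<le> uk k j" if "i < k" for i unfolding j(2) using that by simp
    from perron_normalization(3,4)[OF perron[OF k] k j(1) this]
    show "1 \<le> S k" "S k \<le> (real k)\<^sup>2" using k by (auto simp: S_def)
  qed
  have "1 / real k * ln (inverse (S k)) = - (1 / real k * ln (S k))" for k
    using S(1)[of k] by (cases "k = 0") (auto simp: ln_inverse)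
  then have "(\<lambda>k. 1 / real k * ln (inverse (S k))) \<longlonglongrightarrow> - 0"
    using tendsto_minus[OF subexponential[OF S]] by simp
  then have "log_asymptotic (\<lambda>k j. uk k j * inverse (S k)) D"
    using S(1) by (intro log_asymptotic_mult_subexponential eigenfunction_asymptotics[OF perron]) force+
  then show ?thesis
  proof (rule log_asymptotic_cong)
    fix k j :: nat assume j: "j < k"
    then have k: "k \<ge> 1" by simp
    show "\<mu>k k j = uk k j * inverse (S k)"
      using perron_left_eq(1)[OF perron[OF k] k j] S(1)[OF k] k by (simp add: S_def field_simps)
  qed
qed

section \<open>The large deviation principle for the Gibbs chains\<close>

lemma circle_potential_of_unique_max:
  assumes "continuous_on UNIV V" and per: "\<And>x. V (x + 1) = V x" and "has_unique_max_on_circle V"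
  obtains m where "circle_potential V m"
proof -
  obtain m where m: "m \<in> {0..<1}" "\<And>y. y \<in> {0..<1} \<Longrightarrow> V y \<le> V m"
    and uniq: "\<And>x. \<lbrakk>x \<in> {0..<1}; \<And>y. y \<in> {0..<1} \<Longrightarrow> V y \<le> V x\<rbrakk> \<Longrightarrow> x = m"
    using assms(3) unfolding has_unique_max_on_circle_def by (elim ex1E) blast
  note frac = periodic_frac[of V, OF per]
  have le: "V x \<le> V m" for x
    using m(2)[of "frac x"] frac by (simp add: frac_lt_1)
  have "V x < V m" if "m < x" "x < m + 1" for x
  proof (rule ccontr)
    assume "\<not> ?thesis"
    then have "V (frac x) = V m" using le[of x] frac by simp
    then have "frac x = m" using m(2) by (intro uniq) (auto simp: frac_lt_1)
    then obtain n :: int where "of_int n = x - m" using that by (metis frac_def diff_diff_eq2 add_diff_cancel_left')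
    then have "0 < real_of_int n" "real_of_int n < 1" using that by linarith+
    then show False by simp
  qed
  then have "circle_potential V m" using assms(1) per le by unfold_locales
  then show ?thesis by (rule that)
qed

theorem theorem13:
  fixes V :: "real \<Rightarrow> real"
    and l :: "nat \<Rightarrow> real"
    and uk \<mu>k \<pi>k :: "nat \<Rightarrow> nat \<Rightarrow> real"
  assumes "C2_on_circle V"
    and "has_unique_max_on_circle V"
    and "\<And>k. k \<ge> 1 \<Longrightarrow> perron_data V k (l k) (uk k) (\<mu>k k)"
    and "\<And>k. k \<ge> 1 \<Longrightarrow> stationary_prob k (gibbs_semigroup V k (l k) (uk k)) (\<pi>k k)"
  shows "\<exists>u u_star :: real \<Rightarrow> real.
      uniform_limit {0..<1} (\<lambda>k x. 1 / real k * ln (cont_ext k (uk k) x)) u sequentially \<and>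
      uniform_limit {0..<1} (\<lambda>k x. 1 / real k * ln (cont_ext k (\<mu>k k) x)) u_star sequentially \<and>
      (\<forall>c d. c < d \<longrightarrow>
        (\<lambda>k. 1 / real k * ln (lattice_measure k (\<pi>k k) (arc_set c d)))
          \<longlonglongrightarrow> - (INF x\<in>arc_set c d. deviation_rate u u_star x))"
proof -
  have per: "\<And>x. V (x + 1) = V x" and "continuous_on UNIV V"
    using assms(1) DERIV_continuous unfolding C2_on_circle_def continuous_on_eq_continuous_at[OF open_UNIV]
    by blast+
  then obtain m where "circle_potential V m"
    using circle_potential_of_unique_max assms(2) by blast
  then interpret circle_potential V m .
  have u: "log_asymptotic uk D" by (rule eigenfunction_asymptotics[OF assms(3)])
  have \<mu>: "log_asymptotic \<mu>k D" by (rule eigenprobability_asymptotics[OF assms(3)])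
  have "log_asymptotic \<pi>k (\<lambda>x. D x + D x)"
    using log_asymptotic_mult[OF u \<mu>]
  proof (rule log_asymptotic_cong)
    fix k j :: nat assume "j < k"
    then have "k \<ge> 1" by simp
    then show "\<pi>k k j = uk k j * \<mu>k k j"
      using stationary_prob_eq assms(3,4) \<open>j < k\<close> by blast
  qed
  then have "(\<lambda>k. 1 / real k * ln (lattice_measure k (\<pi>k k) (arc_set c d)))
          \<longlonglongrightarrow> - (INF x\<in>arc_set c d. D x + D x)" if "c < d" for c d
    using that D_nonneg D_periodic D_cont
    by (intro large_deviation_principle continuous_intros) auto
  moreover have "deviation_rate (\<lambda>x. - D x) (\<lambda>x. - D x) = (\<lambda>x. D x + D x)"
    by (simp add: fun_eq_iff deviation_rate_def)
  ultimately show ?thesis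
    using uniform_limit_log_cont_ext[OF D_cont D_periodic u]
      uniform_limit_log_cont_ext[OF D_cont D_periodic \<mu>]
    by (intro exI[of _ "\<lambda>x. - D x"] conjI) auto
qed

end
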